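(* Let $\{\varphi_r\}_{0<r<1}$ be an arbitrary approximate identity and let $\lambda:(0,1)\to(0,\infty)$ with $\lim_{r\to1}\lambda(r)=0$ satisfy $$\Pi(\lambda,\varphi)=\limsup_{r\to1}\lambda(r)\|\varphi_r\|_\infty<\infty .$$ If $\mu\in \mathrm{BV}(\mathbb T)$ is strong differentiable at $x_0\in\mathbb T$, then $$\lim_{\substack{r\to1\\ x\in\lambda(r,x_0)}}\Phi_r(x,d\mu)=\mu'(x_0).$$
   Context: $\mathbb T=\mathbb R/2\pi\mathbb Z$, identified with an interval of length $2\pi$; points are represented by $t$ with $|t|\le\pi$. An approximate identity is a family $\{\varphi_r\}_{0<r<1}\subset L^\infty(\mathbb T)$ such that: ($\Phi1$) $\int_{\mathbb T}\varphi_r(t)\,dt\to1$ as $r\to1$; ($\Phi2$) $\varphi_r^*(x):=\sup_{|x|\le|t|\le\pi}|\varphi_r(t)|\to0$ as $r\to1$ for each $0<|x|\le\pi$; ($\Phi3$) $C_\varphi:=\sup_{0<r<1}\|\varphi_r^*\|_1<\infty$. Here $\varphi_r$ is understood as an everywhere defined bounded Borel function, with $\|\varphi_r\|_\infty=\sup|\varphi_r|$, so that it can be integrated against any finite Borel measure. $\mathrm{BV}(\mathbb T)$ is the class of functions of bounded variation on $\mathbb T$ (i.e. on a period interval; $\mu$ is used only through the finite Borel measure $d\mu$ on $\mathbb T$ it defines and through its local derivatives). $\Phi_r(x,d\mu):=\int_{\mathbb T}\varphi_r(x-t)\,d\mu(t)$. A function of bounded variation $\mu$ is strong differentiable at $x_0$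 if there is a number $c$ such that the variation (function) of $\mu(x)-cx$ has zero derivative at $x=x_0$ (this implies that $\mu'(x_0)$ exists). $\lambda(r,x)$ is the interval $[x-\lambda(r),x+\lambda(r)]\subset\mathbb T$ (equal to $\mathbb T$ if $\lambda(r)\ge\pi$). For a family $F_r$, $\lim_{r\to1,\ \theta\in\lambda(r,x)}F_r(\theta)=A$ means $\lim_{r\to1}\sup_{\theta\in\lambda(r,x)}|F_r(\theta)-A|=0$. *)

theory Defs
  imports "HOL-Analysis.Analysis"
begin

text \<open>
  Functions on the torus \<open>\<real>/2\<pi>\<int>\<close> are \<open>2\<pi>\<close>-periodic functions on \<open>\<real>\<close>, and points of the torus are
  represented by arbitrary real numbers. Only the values \<open>\<phi> r\<close> with \<open>0 < r < 1\<close> of a family \<open>\<phi>\<close>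
  matter.
\<close>

definition torus_periodic :: "(real \<Rightarrow> real) \<Rightarrow> bool" where
  "torus_periodic f \<longleftrightarrow> (\<forall>x. f (x + 2 * pi) = f x)"

definition sup_norm :: "(real \<Rightarrow> real) \<Rightarrow> real" where
  "sup_norm f = (SUP t. \<bar>f t\<bar>)"

definition star_fun :: "(real \<Rightarrow> real) \<Rightarrow> real \<Rightarrow> real" where
  "star_fun f x = (SUP t\<in>{t. \<bar>x\<bar> \<le> \<bar>t\<bar> \<and> \<bar>t\<bar> \<le> pi}. \<bar>f t\<bar>)"

definition approximate_identity :: "(real \<Rightarrow> real \<Rightarrow> real) \<Rightarrow> bool" where
  "approximate_identity \<phi> \<longleftrightarrow>
     (\<forall>r\<in>{0<..<1}. torus_periodic (\<phi> r) \<and> \<phi> r \<in> borel_measurable borel \<and> bounded (range (\<phi> r))) \<and>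
     ((\<lambda>r. LBINT t:{-pi..pi}. \<phi> r t) \<longlongrightarrow> 1) (at_left 1) \<and>
     (\<forall>x. 0 < \<bar>x\<bar> \<and> \<bar>x\<bar> \<le> pi \<longrightarrow> ((\<lambda>r. star_fun (\<phi> r) x) \<longlongrightarrow> 0) (at_left 1)) \<and>
     (SUP r\<in>{0<..<1}. \<integral>\<^sup>+t\<in>{-pi..pi}. ennreal (star_fun (\<phi> r) t) \<partial>lborel) < \<infinity>"

definition variation :: "(real \<Rightarrow> real) \<Rightarrow> real \<Rightarrow> real \<Rightarrow> ennreal" where
  "variation f a b =
     (SUP (n, p)\<in>{(n :: nat, p :: nat \<Rightarrow> real). p 0 = a \<and> p n = b \<and> mono_on {..n} p}.
        \<Sum>i<n. ennreal \<bar>f (p (Suc i)) - f (p i)\<bar>)"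

text \<open>
  The variation function, for functions of bounded variation on every compact interval. It is based
  at \<open>0\<close> (with a sign to the left of \<open>0\<close>); another base point changes it by an additive constant.
\<close>

definition variation_fun :: "(real \<Rightarrow> real) \<Rightarrow> real \<Rightarrow> real" where
  "variation_fun f x =
     (if 0 \<le> x then enn2real (variation f 0 x) else - enn2real (variation f x 0))"

text \<open>
  A function \<open>\<mu>\<close> of bounded variation on a period interval need not take equal values at the two
  endpoints (e.g. \<open>\<mu> t = t\<close>, for which \<open>d\<mu>\<close> is Lebesgue measure). It is represented by its unique
  extension to \<open>\<real>\<close> whose increment over every period is the same; then \<open>d\<mu>\<close> is a \<open>2\<pi>\<close>-periodic
  measure, and local derivatives make sense at every point of the torus. Periodic \<open>\<mu>\<close> is the case of
  increment \<open>0\<close>.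
\<close>

definition BV_torus :: "(real \<Rightarrow> real) \<Rightarrow> bool" where
  "BV_torus \<mu> \<longleftrightarrow>
     (\<exists>d. \<forall>x. \<mu> (x + 2 * pi) = \<mu> x + d) \<and> variation \<mu> (-pi) pi < \<infinity>"

definition strong_differentiable_at :: "(real \<Rightarrow> real) \<Rightarrow> real \<Rightarrow> bool" where
  "strong_differentiable_at \<mu> x\<^sub>0 \<longleftrightarrow>
     (\<exists>c. (variation_fun (\<lambda>x. \<mu> x - c * x) has_real_derivative 0) (at x\<^sub>0))"

text \<open>
  The Lebesgue--Stieltjes integral \<open>\<integral> f d\<mu>\<close> over the torus. The signed measure \<open>d\<mu>\<close>, with
  \<open>d\<mu> (a, b] = \<mu> (b+) - \<mu> (a+)\<close>, is the difference of the measures of the positive and the negative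
  variation of \<open>\<mu>\<close>; these are made right continuous, as \<^const>\<open>interval_measure\<close> requires. The
  half-open period counts the point \<open>\<pi> = -\<pi>\<close> of the torus once.
\<close>

definition right_lim_fun :: "(real \<Rightarrow> real) \<Rightarrow> real \<Rightarrow> real" where
  "right_lim_fun F x = Lim (at_right x) F"

definition pos_measure :: "(real \<Rightarrow> real) \<Rightarrow> real measure" where
  "pos_measure \<mu> = interval_measure (right_lim_fun (\<lambda>x. (variation_fun \<mu> x + \<mu> x) / 2))"

definition neg_measure :: "(real \<Rightarrow> real) \<Rightarrow> real measure" where
  "neg_measure \<mu> = interval_measure (right_lim_fun (\<lambda>x. (variation_fun \<mu> x - \<mu> x) / 2))"

definition torus_stieltjes_integral :: "(real \<Rightarrow> real) \<Rightarrow> (real \<Rightarrow> real) \<Rightarrow> real" where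
  "torus_stieltjes_integral f \<mu> =
     (LINT t:{-pi<..pi}|pos_measure \<mu>. f t) - (LINT t:{-pi<..pi}|neg_measure \<mu>. f t)"

definition Phi :: "(real \<Rightarrow> real \<Rightarrow> real) \<Rightarrow> real \<Rightarrow> real \<Rightarrow> (real \<Rightarrow> real) \<Rightarrow> real" where
  "Phi \<phi> r x \<mu> = torus_stieltjes_integral (\<lambda>t. \<phi> r (x - t)) \<mu>"

definition Pi_const :: "(real \<Rightarrow> real) \<Rightarrow> (real \<Rightarrow> real \<Rightarrow> real) \<Rightarrow> ereal" where
  "Pi_const lam \<phi> = Limsup (at_left 1) (\<lambda>r. ereal (lam r * sup_norm (\<phi> r)))"

text \<open>
  The limit of \<open>F r \<theta>\<close> as \<open>r \<rightarrow> 1\<close>, \<open>\<theta> \<in> \<lambda>(r, x)\<close>, for \<open>2\<pi>\<close>-periodic functions \<open>F r\<close>; for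
  \<open>\<lambda>(r) \<ge> \<pi>\<close> the interval below covers the whole torus. The supremum is taken in the extended
  reals, so that it is meaningful without a boundedness assumption.
\<close>

definition region_limit ::
    "(real \<Rightarrow> real \<Rightarrow> real) \<Rightarrow> (real \<Rightarrow> real) \<Rightarrow> real \<Rightarrow> real \<Rightarrow> bool" where
  "region_limit F lam x A \<longleftrightarrow>
     ((\<lambda>r. SUP \<theta>\<in>{x - lam r .. x + lam r}. ereal \<bar>F r \<theta> - A\<bar>) \<longlongrightarrow> 0) (at_left 1)"

end

theory Submission
  imports Defs
begin

text \<open>
  Let \<open>c\<close> be a number such that the variation function \<open>W\<close> of \<open>\<nu> x = \<mu> x - c x\<close> has derivative zero at
  \<open>x\<^sub>0\<close>. Since \<open>W\<close> dominates the increments of \<open>\<nu>\<close>, this \<open>c\<close> is \<open>\<mu>'(x\<^sub>0)\<close>. The measure \<open>d\<mu>\<close> splits as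
  \<open>c dt + d\<nu>\<close> (\<open>torus_stieltjes_integral_minus_linear\<close>). The part \<open>c dt\<close> contributes \<open>c \<integral> \<phi>\<^sub>r\<close>, which
  tends to \<open>c\<close>, so the claim is that \<open>\<integral> |\<phi>\<^sub>r (x - t)| dm(t)\<close> tends to zero uniformly for
  \<open>|x - x\<^sub>0| \<le> \<lambda>(r)\<close>, where \<open>m\<close> is the measure of \<open>W\<close>, which
  dominates \<open>|d\<nu>|\<close> (\<open>abs_torus_stieltjes_integral_le\<close>).

  The hypothesis \<open>W'(x\<^sub>0) = 0\<close> says that \<open>m\<close> gives mass at most \<open>2 \<epsilon> s\<close> to the interval of radius \<open>s\<close>
  around \<open>x\<^sub>0\<close>, for all \<open>s \<le> \<delta>\<close> (\<open>stieltjes_measure_ball_le\<close>). So on functions of the distance to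
  \<open>x\<^sub>0\<close> that decrease with it, \<open>m\<close> is bounded near \<open>x\<^sub>0\<close> by \<open>\<epsilon>\<close> times Lebesgue measure: the
  superlevel sets of such functions are centred intervals (\<open>nn_integral_antitone_dist_le\<close>).
  This is applied to a decreasing majorant of the shifted kernel (\<open>abs_kernel_le\<close>). If
  \<open>|x - x\<^sub>0| \<le> \<lambda>\<close> then \<open>|\<phi>\<^sub>r (x - t)|\<close> is at most \<open>\<parallel>\<phi>\<^sub>r\<parallel>\<close> for \<open>|t - x\<^sub>0| \<le> 2 \<lambda>\<close>. For larger \<open>|t - x\<^sub>0|\<close>
  one has \<open>|x - t| \<ge> |t - x\<^sub>0| / 2\<close>, and \<open>|\<phi>\<^sub>r (x - t)|\<close> is at most \<open>\<phi>\<^sub>r\<^sup>* (|t - x\<^sub>0| / 2)\<close>.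
  The Lebesgue integral of this majorant is at most \<open>4 \<lambda>(r) \<parallel>\<phi>\<^sub>r\<parallel> + 2 \<parallel>\<phi>\<^sub>r\<^sup>*\<parallel>\<^sub>1\<close>, which stays
  bounded by the two hypotheses \<open>\<Pi>(\<lambda>, \<phi>) < \<infinity>\<close> and \<open>C\<^sub>\<phi> < \<infinity>\<close>. Away from \<open>x\<^sub>0\<close> the kernel is at
  most \<open>\<phi>\<^sub>r\<^sup>* (\<delta> / 2)\<close>, which tends to zero, while \<open>m\<close> has finite mass on a period.
\<close>

section \<open>Right limits of monotone functions\<close>

lemma right_lim_fun_eqI: "(F \<longlongrightarrow> l) (at_right x) \<Longrightarrow> right_lim_fun F x = l"
  unfolding right_lim_fun_def by (intro tendsto_Lim) auto

lemma tendsto_right_lim_fun: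
  assumes "mono F"
  shows "(F \<longlongrightarrow> right_lim_fun F x) (at_right x)"
proof -
  have "(F \<longlongrightarrow> Inf (F ` ({x<..} \<inter> UNIV))) (at x within ({x<..} \<inter> UNIV))"
    by (rule Lim_right_bound[where K="F x"]) (use assms in \<open>auto simp: mono_def\<close>)
  then show ?thesis
    using right_lim_fun_eqI[of F _ x] by auto
qed

lemma le_right_lim_fun:
  assumes "mono F" "y \<le> x" shows "F y \<le> right_lim_fun F x"
  by (rule tendsto_lowerbound[OF tendsto_right_lim_fun[OF assms(1)]])
    (use assms in \<open>auto simp: eventually_at_right_field mono_def intro!: exI[of _ "x + 1"]\<close>)

lemma right_lim_fun_le:
  assumes "mono F" "x < y" shows "right_lim_fun F x \<le> F y"
  by (rule tendsto_upperbound[OF tendsto_right_lim_fun[OF assms(1)]])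
    (use assms in \<open>auto simp: eventually_at_right_field mono_def intro!: exI[of _ y]\<close>)

lemma right_lim_fun_mono:
  assumes "mono F" "x \<le> y" shows "right_lim_fun F x \<le> right_lim_fun F y"
proof (cases "x = y")
  case False
  then have "x < y" using assms by simp
  then show ?thesis
    using right_lim_fun_le[OF assms(1)] le_right_lim_fun[OF assms(1) order_refl, of y] by fastforce
qed simp

lemma continuous_right_lim_fun:
  assumes "mono F" shows "continuous (at_right x) (right_lim_fun F)"
  unfolding continuous_within
proof (rule order_tendstoI)
  fix a assume "a < right_lim_fun F x"
  then show "\<forall>\<^sub>F y in at_right x. a < right_lim_fun F y"
    using right_lim_fun_mono[OF assms]
    by (auto simp: eventually_at_right_field intro!: exI[of _ "x + 1"] intro: less_le_trans less_imp_le)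
next
  fix a assume "right_lim_fun F x < a"
  from order_tendstoD(2)[OF tendsto_right_lim_fun[OF assms] this]
  obtain b where b: "b > x" "\<And>y. x < y \<Longrightarrow> y < b \<Longrightarrow> F y < a"
    by (auto simp: eventually_at_right_field)
  have "right_lim_fun F y < a" if "x < y" "y < b" for y
    using right_lim_fun_le[OF assms, of y "(y + b) / 2"] b(2)[of "(y + b) / 2"] that by auto
  then show "\<forall>\<^sub>F y in at_right x. right_lim_fun F y < a"
    using b(1) by (auto simp: eventually_at_right_field)
qed

lemma right_lim_fun_add:
  assumes "mono F" "mono G"
  shows "right_lim_fun (\<lambda>x. F x + G x) x = right_lim_fun F x + right_lim_fun G x"
  by (intro right_lim_fun_eqI tendsto_add tendsto_right_lim_fun assms)

lemma right_lim_fun_linear: "right_lim_fun (\<lambda>x. k * x) x = k * x"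
  by (intro right_lim_fun_eqI tendsto_intros)

lemma right_lim_fun_quasiperiodic:
  assumes "mono F" "\<And>x. F (x + T) = F x + D"
  shows "right_lim_fun F (x + T) = right_lim_fun F x + D"
proof -
  have "((\<lambda>y. F (y + T)) \<longlongrightarrow> right_lim_fun F x + D) (at_right x)"
    unfolding assms(2) by (intro tendsto_intros tendsto_right_lim_fun assms)
  then have "(F \<longlongrightarrow> right_lim_fun F x + D) (at_right (x + T))"
    unfolding filterlim_at_right_to_0[of _ _ x] filterlim_at_right_to_0[of _ _ "x + T"]
    by (simp add: add_ac)
  then show ?thesis by (rule right_lim_fun_eqI)
qed

section \<open>Lebesgue--Stieltjes measures of monotone functions\<close>

text \<open>
  Increments of \<^const>\<open>interval_measure\<close> are those of its function only under right continuity;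
  passing to right limits makes the measure meaningful for every monotone function, and additive in it.
\<close>
definition stieltjes_measure :: "(real \<Rightarrow> real) \<Rightarrow> real measure" where
  "stieltjes_measure F = interval_measure (right_lim_fun F)"

lemma sets_stieltjes_measure [simp, measurable_cong]: "sets (stieltjes_measure F) = sets borel"
  by (simp add: stieltjes_measure_def)

lemma space_stieltjes_measure [simp]: "space (stieltjes_measure F) = UNIV"
  by (simp add: stieltjes_measure_def)

lemma emeasure_stieltjes_measure_Ioc:
  assumes "mono F" "a \<le> b"
  shows "emeasure (stieltjes_measure F) {a<..b} = right_lim_fun F b - right_lim_fun F a"
  unfolding stieltjes_measure_def
  by (rule emeasure_interval_measure_Ioc)
    (use assms right_lim_fun_mono continuous_right_lim_fun in auto)

lemma sigma_finite_stieltjes_measure: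
  "mono F \<Longrightarrow> sigma_finite_measure (stieltjes_measure F)"
  unfolding stieltjes_measure_def
  by (rule sigma_finite_interval_measure) (use right_lim_fun_mono continuous_right_lim_fun in auto)

text \<open>
  The half-open intervals are stable under intersection, generate the Borel sets, and have
  finite measure, so they determine the measure.
\<close>
lemma measure_eq_stieltjes_measureI:
  assumes F: "mono F" and sets: "sets M = sets borel"
    and eq: "\<And>a b. a \<le> b \<Longrightarrow> emeasure M {a<..b} = right_lim_fun F b - right_lim_fun F a"
  shows "M = stieltjes_measure F"
proof (rule measure_eqI_generator_eq)
  let ?E = "range (\<lambda>(a, b). {a<..b}::real set)"
  show "Int_stable ?E"
    unfolding Int_stable_def
  proof safe
    fix a b c d :: real
    have "{a<..b} \<inter> {c<..d} = {max a c<..min b d}" by auto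
    then show "{a<..b} \<inter> {c<..d} \<in> ?E" by auto
  qed
  show "sets M = sigma_sets UNIV ?E" "sets (stieltjes_measure F) = sigma_sets UNIV ?E"
    by (simp_all add: sets borel_sigma_sets_Ioc)
  show "range (\<lambda>n. {- real n<..real n}) \<subseteq> ?E" by auto
  show "(\<Union>n. {- real n<..real n}) = UNIV"
  proof -
    have "\<exists>n. - real n < x \<and> x \<le> real n" for x
      using reals_Archimedean2[of "\<bar>x\<bar>"] by (metis abs_le_iff abs_less_iff less_imp_le minus_less_iff)
    then show ?thesis by auto
  qed
  show "emeasure M {- real n<..real n} \<noteq> \<infinity>" for n
    by (subst eq) auto
  fix X assume "X \<in> ?E"
  then obtain a b where X: "X = {a<..b}" by auto
  show "emeasure M X = emeasure (stieltjes_measure F) X"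
    unfolding X by (cases "a \<le> b") (auto simp: eq emeasure_stieltjes_measure_Ioc F)
qed auto

lemma stieltjes_measure_linear:
  assumes "0 \<le> k"
  shows "stieltjes_measure (\<lambda>x. k * x) = density lborel (\<lambda>_. ennreal k)"
proof (rule measure_eq_stieltjes_measureI[symmetric])
  show "mono ((*) k)" using assms by (auto simp: mono_def intro: mult_left_mono)
  fix a b :: real assume "a \<le> b"
  then show "emeasure (density lborel (\<lambda>_. ennreal k)) {a<..b} = right_lim_fun ((*) k) b - right_lim_fun ((*) k) a"
    using assms by (simp add: emeasure_density_const right_lim_fun_linear ennreal_mult[symmetric] right_diff_distrib)
qed simp

lemma stieltjes_measure_shift:
  assumes "mono F" "\<And>x. F (x + T) = F x + D"
  shows "distr (stieltjes_measure F) borel (\<lambda>t. t + T) = stieltjes_measure F"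
proof (rule measure_eq_stieltjes_measureI[OF assms(1)])
  fix a b :: real assume "a \<le> b"
  have "(\<lambda>t. t + T) -` {a<..b} = {a - T<..b - T}" by auto
  then show "emeasure (distr (stieltjes_measure F) borel (\<lambda>t. t + T)) {a<..b} = right_lim_fun F b - right_lim_fun F a"
    using \<open>a \<le> b\<close> right_lim_fun_quasiperiodic[OF assms, of "a - T"] right_lim_fun_quasiperiodic[OF assms, of "b - T"]
    by (simp add: emeasure_distr emeasure_stieltjes_measure_Ioc assms(1))
qed simp

text \<open>
  The sum of the two measures has the right values on half-open intervals, hence is the measure
  of the sum. Its integrals are computed by induction on the integrand.
\<close>
lemma nn_integral_stieltjes_measure_add:
  assumes F: "mono F" and G: "mono G" and [measurable]: "f \<in> borel_measurable borel"
  shows "(\<integral>\<^sup>+t. f t \<partial>stieltjes_measure (\<lambda>x. F x + G x)) =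
    (\<integral>\<^sup>+t. f t \<partial>stieltjes_measure F) + (\<integral>\<^sup>+t. f t \<partial>stieltjes_measure G)"
proof -
  let ?e = "\<lambda>A. emeasure (stieltjes_measure F) A + emeasure (stieltjes_measure G) A"
  define S where "S = measure_of UNIV (sets borel) ?e"
  have sets_S [measurable_cong]: "sets S = sets borel" "space S = UNIV"
    using sets.sigma_sets_eq[of "borel :: real measure"] sets.space_closed[of "borel :: real measure"]
    by (auto simp: S_def)
  have em: "emeasure S A = ?e A" if "A \<in> sets borel" for A
    unfolding S_def
  proof (rule emeasure_measure_of_sigma)
    show "sigma_algebra UNIV (sets (borel :: real measure))"
      using sets.sigma_algebra_axioms[of "borel :: real measure"] by simp
    show "countably_additive (sets borel) ?e"
      unfolding countably_additive_def
      by (auto simp: suminf_add[symmetric] suminf_emeasure)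
  qed (use that in \<open>auto simp: positive_def\<close>)
  have FG: "mono (\<lambda>x. F x + G x)"
    using F G by (auto simp: mono_def intro!: add_mono)
  have "S = stieltjes_measure (\<lambda>x. F x + G x)"
  proof (rule measure_eq_stieltjes_measureI[OF FG])
    fix a b :: real assume "a \<le> b"
    then show "emeasure S {a<..b} = right_lim_fun (\<lambda>x. F x + G x) b - right_lim_fun (\<lambda>x. F x + G x) a"
      using right_lim_fun_mono[OF F, of a b] right_lim_fun_mono[OF G, of a b]
      by (simp add: em emeasure_stieltjes_measure_Ioc F G right_lim_fun_add ennreal_plus[symmetric] 
         algebra_simps del: ennreal_plus)
  qed (simp add: sets_S)
  moreover have "(\<integral>\<^sup>+t. f t \<partial>S) = (\<integral>\<^sup>+t. f t \<partial>stieltjes_measure F) + (\<integral>\<^sup>+t. f t \<partial>stieltjes_measure G)"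
    using assms(3)
  proof (induction rule: borel_measurable_induct)
    case (cong f g)
    then have "f = g" by auto
    then show ?case using cong by simp
  next
    case (set A)
    then show ?case by (simp add: em sets_S)
  next
    case (mult u c)
    then have [measurable]: "u \<in> borel_measurable borel" by simp
    show ?case using mult by (simp add: nn_integral_cmult sets_S distrib_left)
  next
    case (add u v)
    then have [measurable]: "u \<in> borel_measurable borel" "v \<in> borel_measurable borel" by simp_all
    show ?case using add by (simp add: nn_integral_add sets_S ac_simps)
  next
    case (seq U)
    then have [measurable]: "\<And>i. U i \<in> borel_measurable borel" by simp
    have inc: "incseq (\<lambda>i. \<integral>\<^sup>+t. U i t \<partial>M)" for M
      using \<open>incseq U\<close> by (auto simp: incseq_def le_fun_def intro!: nn_integral_mono)
    have MC: "(\<integral>\<^sup>+t. (SUP i. U i) t \<partial>M) = (SUP i. \<integral>\<^sup>+t. U i t \<partial>M)" if "sets M = sets borel" for M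
      unfolding SUP_apply
      by (rule nn_integral_monotone_convergence_SUP) (use seq in \<open>auto simp: measurable_cong_sets[OF that refl]\<close>)
    have "(\<integral>\<^sup>+t. (SUP i. U i) t \<partial>S) = (SUP i. (\<integral>\<^sup>+t. U i t \<partial>stieltjes_measure F) + (\<integral>\<^sup>+t. U i t \<partial>stieltjes_measure G))"
      unfolding MC[OF sets_S(1)] using seq by (simp del: SUP_apply Sup_apply)
    also have "\<dots> = (SUP i. \<integral>\<^sup>+t. U i t \<partial>stieltjes_measure F) + (SUP i. \<integral>\<^sup>+t. U i t \<partial>stieltjes_measure G)"
      by (rule ennreal_SUP_add[OF inc inc])
    finally show ?case
      by (simp add: MC del: SUP_apply Sup_apply)
  qed
  ultimately show ?thesis by simp
qed

lemma set_integrable_stieltjes_measure: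
  fixes f :: "real \<Rightarrow> real"
  assumes "mono F" "f \<in> borel_measurable borel" "bounded (range f)"
  shows "set_integrable (stieltjes_measure F) {a<..b} f"
proof -
  obtain B where B: "\<And>x. \<bar>f x\<bar> \<le> B"
    using assms(3) by (auto simp: bounded_iff)
  have "emeasure (stieltjes_measure F) {a<..b} < \<infinity>"
    by (cases "a \<le> b") (auto simp: emeasure_stieltjes_measure_Ioc assms(1))
  then show ?thesis unfolding set_integrable_def
    by (intro integrableI_bounded_set_indicator[where B=B]) (use assms(2) B in auto)
qed

text \<open>
  Together with the positive and negative variations of two functions, this turns a pointwise
  identity between sums of monotone functions into an identity between integrals.
\<close>
lemma set_integral_stieltjes_measure_add:
  fixes f :: "real \<Rightarrow> real"
  assumes F: "mono F" and G: "mono G" and f [measurable]: "f \<in> borel_measurable borel" "bounded (range f)"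
  shows "(LINT t:{a<..b}|stieltjes_measure (\<lambda>x. F x + G x). f t) =
    (LINT t:{a<..b}|stieltjes_measure F. f t) + (LINT t:{a<..b}|stieltjes_measure G. f t)"
proof -
  let ?f = "\<lambda>t. indicator {a<..b} t * f t"
  have FG: "mono (\<lambda>x. F x + G x)"
    using F G by (auto simp: mono_def intro!: add_mono)
  have int: "integrable (stieltjes_measure H) ?f" if "mono H" for H
    using set_integrable_stieltjes_measure[OF that f, of a b] by (simp add: set_integrable_def)
  have fin: "(\<integral>\<^sup>+t. ennreal (?f t) \<partial>stieltjes_measure H) < top"
      "(\<integral>\<^sup>+t. ennreal (- ?f t) \<partial>stieltjes_measure H) < top" if "mono H" for H
    using integrableD(2,3)[OF int[OF that]] by (simp_all add: less_top[symmetric])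
  show ?thesis
    unfolding set_lebesgue_integral_def real_scaleR_def
    using fin[OF F] fin[OF G]
    by (simp add: real_lebesgue_integral_def int F G FG nn_integral_stieltjes_measure_add enn2real_plus)
qed

text \<open>
  Both windows together with the gap between their left ends fill the same interval: if
  \<open>a \<le> b\<close> then \<open>(a, b] \<union> (b, b + T] = (a, a + T] \<union> (a + T, b + T]\<close>. The gap \<open>(a, b]\<close> and its translate
  have the same integral, which is finite and cancels.
\<close>
lemma set_integral_stieltjes_measure_periodic:
  fixes f :: "real \<Rightarrow> real"
  assumes F: "mono F" "\<And>x. F (x + T) = F x + D" and "0 \<le> T"
    and f [measurable]: "f \<in> borel_measurable borel" "bounded (range f)" and f_per: "\<And>x. f (x + T) = f x"
  shows "(LINT t:{a<..a+T}|stieltjes_measure F. f t) = (LINT t:{b<..b+T}|stieltjes_measure F. f t)"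
proof -
  let ?I = "\<lambda>a b. LINT t:{a<..b}|stieltjes_measure F. f t"
  have shift: "?I (a + T) (b + T) = ?I a b" for a b
  proof -
    have "?I (a + T) (b + T) = (LINT t:{a+T<..b+T}|distr (stieltjes_measure F) borel (\<lambda>t. t + T). f t)"
      by (simp add: stieltjes_measure_shift[OF F])
    also have "\<dots> = (LINT t|stieltjes_measure F. indicator {a+T<..b+T} (t + T) *\<^sub>R f (t + T))"
      unfolding set_lebesgue_integral_def by (rule integral_distr) auto
    also have "\<dots> = ?I a b"
      unfolding set_lebesgue_integral_def f_per by (intro Bochner_Integration.integral_cong) (auto simp: indicator_def)
    finally show ?thesis .
  qed
  have split: "?I a c = ?I a b + ?I b c" if "a \<le> b" "b \<le> c" for a b c
  proof -
    have "{a<..c} = {a<..b} \<union> {b<..c}" using that by auto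
    then show ?thesis
      using set_integral_Un[of "{a<..b}" "{b<..c}" "stieltjes_measure F" f] set_integrable_stieltjes_measure[OF F(1) f]
      by auto
  qed
  have "?I a (a + T) = ?I b (b + T)" if "a \<le> b" for a b
    using split[of a b "b + T"] split[of a "a + T" "b + T"] shift[of a b] that \<open>0 \<le> T\<close> by simp
  then show ?thesis by (metis linear)
qed


section \<open>The variation function\<close>

lemma variation_upper:
  assumes "p 0 = a" "p n = b" "mono_on {..n} p"
  shows "(\<Sum>i<n. ennreal \<bar>f (p (Suc i)) - f (p i)\<bar>) \<le> variation f a b"
  unfolding variation_def by (rule SUP_upper2[of "(n, p)"]) (use assms in auto)

lemma variation_least:
  assumes "\<And>n p. p 0 = a \<Longrightarrow> p n = b \<Longrightarrow> mono_on {..n} p \<Longrightarrow>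
    (\<Sum>i<n. ennreal \<bar>f (p (Suc i)) - f (p i)\<bar>) \<le> C"
  shows "variation f a b \<le> C"
  unfolding variation_def by (rule SUP_least) (use assms in auto)

lemma increment_le_variation:
  assumes "a \<le> b" shows "ennreal \<bar>f b - f a\<bar> \<le> variation f a b"
  using variation_upper[of "\<lambda>i::nat. if i = 0 then a else b" a 1 b f] assms
  by (auto simp: mono_on_def)

text \<open>
  For the upper bound a partition \<open>p\<close> of \<open>[a, c]\<close> is split into \<open>min b p\<close> and \<open>max b p\<close>. These are
  partitions of \<open>[a, b]\<close> and \<open>[b, c]\<close>, and a step of \<open>p\<close> across \<open>b\<close> is handled by the triangle
  inequality. For the lower bound partitions are concatenated.
\<close>
lemma variation_add:
  assumes "a \<le> b" "b \<le> c"
  shows "variation f a c = variation f a b + variation f b c"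
proof (rule antisym)
  show "variation f a c \<le> variation f a b + variation f b c"
  proof (rule variation_least)
    fix n p assume p: "p 0 = a" "p n = c" "mono_on {..n::nat} p"
    have *: "ennreal \<bar>f (p (Suc i)) - f (p i)\<bar> \<le>
        ennreal \<bar>f (min b (p (Suc i))) - f (min b (p i))\<bar> + ennreal \<bar>f (max b (p (Suc i))) - f (max b (p i))\<bar>"
      if "i < n" for i
    proof -
      have "p i \<le> p (Suc i)" using p(3) that by (auto simp: mono_on_def)
      then have "\<bar>f (p (Suc i)) - f (p i)\<bar> \<le>
        \<bar>f (min b (p (Suc i))) - f (min b (p i))\<bar> + \<bar>f (max b (p (Suc i))) - f (max b (p i))\<bar>"
        by (auto simp: min_def max_def)
      then show ?thesis by (simp add: ennreal_plus[symmetric] del: ennreal_plus)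
    qed
    have "(\<Sum>i<n. ennreal \<bar>f (p (Suc i)) - f (p i)\<bar>) \<le>
      (\<Sum>i<n. ennreal \<bar>f (min b (p (Suc i))) - f (min b (p i))\<bar>) +
      (\<Sum>i<n. ennreal \<bar>f (max b (p (Suc i))) - f (max b (p i))\<bar>)"
      unfolding sum.distrib[symmetric] using * by (intro sum_mono) auto
    also have "\<dots> \<le> variation f a b + variation f b c"
    proof (intro add_mono)
      show "(\<Sum>i<n. ennreal \<bar>f (min b (p (Suc i))) - f (min b (p i))\<bar>) \<le> variation f a b"
        by (rule variation_upper[where p="\<lambda>i. min b (p i)"])
          (use p assms in \<open>auto simp: mono_on_def min.coboundedI2\<close>)
      show "(\<Sum>i<n. ennreal \<bar>f (max b (p (Suc i))) - f (max b (p i))\<bar>) \<le> variation f b c"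
        by (rule variation_upper[where p="\<lambda>i. max b (p i)"])
          (use p assms in \<open>auto simp: mono_on_def max.coboundedI2\<close>)
    qed
    finally show "(\<Sum>i<n. ennreal \<bar>f (p (Suc i)) - f (p i)\<bar>) \<le> variation f a b + variation f b c" .
  qed
next
  let ?P = "\<lambda>a b. {(n :: nat, p :: nat \<Rightarrow> real). p 0 = a \<and> p n = b \<and> mono_on {..n} p}"
  let ?S = "\<lambda>(n, p). \<Sum>i<n. ennreal \<bar>f (p (Suc i)) - f (p i)\<bar>"
  have ne: "?P u v \<noteq> {}" if "u \<le> v" for u v
    using that by (auto simp: mono_on_def intro!: exI[of _ 1] exI[of _ "\<lambda>i. if i = 0 then u else v"])
  have concat: "?S x + ?S y \<le> variation f a c" if x: "x \<in> ?P a b" and y: "y \<in> ?P b c" for x y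
  proof -
    obtain n p m q where eq: "x = (n, p)" "y = (m, q)" by (cases x; cases y)
    define r where "r i = (if i \<le> n then p i else q (i - n))" for i
    have pq: "p 0 = a" "p n = b" "mono_on {..n} p" "q 0 = b" "q m = c" "mono_on {..m} q"
      using x y by (auto simp: eq)
    have "?S x + ?S y = (\<Sum>i<n. ennreal \<bar>f (r (Suc i)) - f (r i)\<bar>) + (\<Sum>i<m. ennreal \<bar>f (r (Suc (n + i))) - f (r (n + i))\<bar>)"
      unfolding eq prod.case
      by (intro arg_cong2[where f="(+)"] sum.cong) (use pq in \<open>auto simp: r_def Suc_diff_le\<close>)
    also have "\<dots> = (\<Sum>i<n + m. ennreal \<bar>f (r (Suc i)) - f (r i)\<bar>)"
      by (induction m) (auto simp: add_ac)
    also have "\<dots> \<le> variation f a c"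
    proof (rule variation_upper)
      show "r 0 = a" "r (n + m) = c" using pq by (auto simp: r_def)
      show "mono_on {..n + m} r"
      proof (rule mono_onI)
        fix i j assume ij: "i \<in> {..n + m}" "j \<in> {..n + m}" "i \<le> j"
        have 1: "p k \<le> b" if "k \<le> n" for k using mono_onD[OF pq(3), of k n] that pq by auto
        have 2: "b \<le> q k" if "k \<le> m" for k using mono_onD[OF pq(6), of 0 k] that pq by auto
        have "j - n \<le> m" using ij by auto
        then show "r i \<le> r j"
          using ij 1[of i] 2[of "j - n"] mono_onD[OF pq(3), of i j] mono_onD[OF pq(6), of "i - n" "j - n"]
          by (auto simp: r_def)
      qed
    qed
    finally show ?thesis .
  qed
  have "variation f a b + variation f b c = (SUP x\<in>?P a b. ?S x + (SUP y\<in>?P b c. ?S y))"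
    unfolding variation_def by (rule ennreal_SUP_add_left[symmetric, OF ne[OF assms(1)]])
  also have "\<dots> = (SUP x\<in>?P a b. SUP y\<in>?P b c. ?S x + ?S y)"
    by (intro SUP_cong refl ennreal_SUP_add_right ne assms(2))
  also have "\<dots> \<le> variation f a c"
    by (intro SUP_least concat)
  finally show "variation f a b + variation f b c \<le> variation f a c" .
qed

lemma variation_quasiperiodic:
  assumes "\<And>x. f (x + T) = f x + D"
  shows "variation f (a + T) (b + T) = variation f a b"
proof -
  have le: "variation f a b \<le> variation f (a + T) (b + T)" if "\<And>x. f (x + T) = f x + D" for a b T D
  proof (rule variation_least)
    fix n p assume "p 0 = a" "p n = b" "mono_on {..n::nat} p"
    then show "(\<Sum>i<n. ennreal \<bar>f (p (Suc i)) - f (p i)\<bar>) \<le> variation f (a + T) (b + T)"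
      using variation_upper[of "\<lambda>i. p i + T" "a + T" n "b + T" f] by (auto simp: mono_on_def that)
  qed
  have "f (x + (- T)) = f x + (- D)" for x
    using assms[of "x - T"] by simp
  from le[OF this, of "a + T" "b + T"] le[OF assms, of a b] show ?thesis by simp
qed

lemma variation_minus_linear_le:
  assumes "a \<le> b"
  shows "variation (\<lambda>x. f x - c * x) a b \<le> variation f a b + ennreal (\<bar>c\<bar> * (b - a))"
proof (rule variation_least)
  fix n p assume p: "p 0 = a" "p n = b" "mono_on {..n::nat} p"
  have "ennreal \<bar>f (p (Suc i)) - c * p (Suc i) - (f (p i) - c * p i)\<bar> \<le>
      ennreal \<bar>f (p (Suc i)) - f (p i)\<bar> + ennreal (\<bar>c\<bar> * (p (Suc i) - p i))" if "i < n" for i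
  proof -
    have "p i \<le> p (Suc i)" using p(3) that by (auto simp: mono_on_def)
    moreover have "\<bar>f (p (Suc i)) - c * p (Suc i) - (f (p i) - c * p i)\<bar> \<le> \<bar>f (p (Suc i)) - f (p i)\<bar> + \<bar>c * (p (Suc i) - p i)\<bar>"
      by (simp add: right_diff_distrib)
    ultimately show ?thesis by (simp add: ennreal_plus[symmetric] abs_mult del: ennreal_plus)
  qed
  then have "(\<Sum>i<n. ennreal \<bar>f (p (Suc i)) - c * p (Suc i) - (f (p i) - c * p i)\<bar>) \<le>
    (\<Sum>i<n. ennreal \<bar>f (p (Suc i)) - f (p i)\<bar>) + (\<Sum>i<n. ennreal (\<bar>c\<bar> * (p (Suc i) - p i)))"
    unfolding sum.distrib[symmetric] by (intro sum_mono) auto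
  also have "(\<Sum>i<n. ennreal (\<bar>c\<bar> * (p (Suc i) - p i))) = ennreal (\<Sum>i<n. \<bar>c\<bar> * (p (Suc i) - p i))"
    using p(3) by (intro sum_ennreal) (auto simp: mono_on_def)
  also have "(\<Sum>i<n. \<bar>c\<bar> * (p (Suc i) - p i)) = \<bar>c\<bar> * (b - a)"
    using p by (simp add: sum_distrib_left[symmetric] sum_lessThan_telescope)
  finally show "(\<Sum>i<n. ennreal \<bar>f (p (Suc i)) - c * p (Suc i) - (f (p i) - c * p i)\<bar>)
      \<le> variation f a b + ennreal (\<bar>c\<bar> * (b - a))"
    using variation_upper[OF p, of f] by (auto intro: order_trans add_right_mono)
qed

lemma BV_torus_minus_linear:
  assumes "BV_torus f" shows "BV_torus (\<lambda>x. f x - c * x)"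
  unfolding BV_torus_def
proof
  obtain d where "\<And>x. f (x + 2 * pi) = f x + d" using assms by (auto simp: BV_torus_def)
  then have "\<forall>x. f (x + 2 * pi) - c * (x + 2 * pi) = f x - c * x + (d - c * (2 * pi))"
    by (simp add: algebra_simps)
  then show "\<exists>d. \<forall>x. f (x + 2 * pi) - c * (x + 2 * pi) = f x - c * x + d" ..
  show "variation (\<lambda>x. f x - c * x) (- pi) pi < \<infinity>"
    using variation_minus_linear_le[of "- pi" pi f c] assms
    by (auto simp: BV_torus_def intro: le_less_trans)
qed

text \<open>
  Bounded variation on one period spreads to all of \<open>\<real>\<close>, as all translates by whole periods
  have the same variation.
\<close>
lemma variation_finite:
  assumes "BV_torus f" "a \<le> b" shows "variation f a b < \<infinity>"
proof -
  obtain d where d: "\<And>x. f (x + 2 * pi) = f x + d" using assms by (auto simp: BV_torus_def)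
  let ?R = "\<lambda>n::nat. pi + 2 * pi * real n"
  have right: "variation f (?R n) (?R (Suc n)) = variation f (- pi) pi" for n
  proof (induction n)
    case 0
    show ?case using variation_quasiperiodic[where f=f and T="2 * pi" and D=d, OF d, of "- pi" pi] by (simp add: algebra_simps)
  next
    case (Suc n)
    then show ?case using variation_quasiperiodic[where f=f and T="2 * pi" and D=d, OF d, of "?R n" "?R (Suc n)"] by (simp add: algebra_simps)
  qed
  have left: "variation f (- ?R (Suc n)) (- ?R n) = variation f (- pi) pi" for n
  proof (induction n)
    case 0
    show ?case using variation_quasiperiodic[where f=f and T="2 * pi" and D=d, OF d, of "- pi - 2 * pi" "- pi"] by (simp add: algebra_simps)
  next
    case (Suc n)
    then show ?case using variation_quasiperiodic[where f=f and T="2 * pi" and D=d, OF d, of "- ?R (Suc (Suc n))" "- ?R (Suc n)"] by (simp add: algebra_simps)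
  qed
  have fin: "variation f (- ?R n) (?R n) < \<infinity>" for n
  proof (induction n)
    case 0
    show ?case using assms(1) by (simp add: BV_torus_def)
  next
    case (Suc n)
    have "variation f (- y) y = variation f (- y) (- x) + (variation f (- x) x + variation f x y)"
      if "0 \<le> x" "x \<le> y" for x y
      using that variation_add[of "- y" "- x" y f] variation_add[of "- x" x y f] by simp
    from this[of "?R n" "?R (Suc n)"]
    have "variation f (- ?R (Suc n)) (?R (Suc n)) =
      variation f (- ?R (Suc n)) (- ?R n) + (variation f (- ?R n) (?R n) + variation f (?R n) (?R (Suc n)))"
      by (auto simp: algebra_simps)
    then show ?case unfolding left right using Suc assms(1) by (simp add: BV_torus_def)
  qed
  obtain n :: nat where n: "max \<bar>a\<bar> \<bar>b\<bar> \<le> real n" using real_arch_simple by blast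
  have "1 * real n \<le> (2 * pi) * real n" using pi_gt3 by (intro mult_right_mono) auto
  then have "- ?R n \<le> a" "b \<le> ?R n" using n pi_gt_zero by linarith+
  then have "variation f (- ?R n) (?R n) = variation f (- ?R n) a + (variation f a b + variation f b (?R n))"
    using assms(2) variation_add[of "- ?R n" a "?R n" f] variation_add[of a b "?R n" f] by auto
  then show ?thesis using fin[of n] by auto
qed

lemma variation_fun_diff:
  assumes "BV_torus f" "x \<le> y"
  shows "variation_fun f y - variation_fun f x = enn2real (variation f x y)"
proof -
  note fin = variation_finite[OF assms(1)]
  have add: "enn2real (variation f a c) = enn2real (variation f a b) + enn2real (variation f b c)"
    if "a \<le> b" "b \<le> c" for a b c
    using fin that by (simp add: variation_add[OF that] enn2real_plus)
  show ?thesis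
    using assms(2) add[of 0 x y] add[of x 0 y] add[of x y 0]
    by (auto simp: variation_fun_def)
qed

lemma abs_diff_le_variation_fun:
  assumes "BV_torus f" "x \<le> y"
  shows "\<bar>f y - f x\<bar> \<le> variation_fun f y - variation_fun f x"
proof -
  have "ennreal \<bar>f y - f x\<bar> \<le> ennreal (enn2real (variation f x y))"
    using increment_le_variation[OF assms(2), of f] variation_finite[OF assms] by simp
  then show ?thesis by (simp add: variation_fun_diff[OF assms])
qed

text \<open>
  The positive and negative variations: the increments of the variation function dominate those
  of the function.
\<close>
lemma mono_variation_fun:
  assumes "BV_torus f"
  shows "mono (variation_fun f)"
    and "mono (\<lambda>x. (variation_fun f x + f x) / 2)" "mono (\<lambda>x. (variation_fun f x - f x) / 2)"
  using abs_diff_le_variation_fun[OF assms] by (fastforce simp: mono_def)+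

lemma variation_fun_quasiperiodic:
  assumes "BV_torus f"
  shows "variation_fun f (x + 2 * pi) = variation_fun f x + variation_fun f (2 * pi)"
proof -
  obtain d where d: "\<And>x. f (x + 2 * pi) = f x + d" using assms by (auto simp: BV_torus_def)
  have *: "variation_fun f (b + 2 * pi) - variation_fun f (a + 2 * pi) = variation_fun f b - variation_fun f a"
    if "a \<le> b" for a b
    using that by (simp add: variation_fun_diff[OF assms] variation_quasiperiodic[where f=f and T="2 * pi" and D=d, OF d])
  have "variation_fun f 0 = 0"
    using variation_fun_diff[OF assms, of 0 0] by (simp add: variation_fun_def)
  then show ?thesis using *[of 0 x] *[of x 0] by (cases "0 \<le> x") auto
qed


text \<open>
  The difference quotients of \<open>\<mu> x - c x\<close> are dominated by those of its variation function, so
  they tend to zero.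
\<close>
lemma strong_derivative:
  assumes \<mu>: "BV_torus \<mu>" and "(variation_fun (\<lambda>x. \<mu> x - c * x) has_real_derivative 0) (at a)"
  shows "(\<mu> has_real_derivative c) (at a)"
proof -
  define \<nu> where "\<nu> = (\<lambda>x. \<mu> x - c * x)"
  have \<nu>: "BV_torus \<nu>" unfolding \<nu>_def by (rule BV_torus_minus_linear[OF \<mu>])
  have le: "\<bar>\<nu> y - \<nu> a\<bar> \<le> \<bar>variation_fun \<nu> y - variation_fun \<nu> a\<bar>" for y
    using abs_diff_le_variation_fun[OF \<nu>, of a y] abs_diff_le_variation_fun[OF \<nu>, of y a] by linarith
  have "((\<lambda>y. (variation_fun \<nu> y - variation_fun \<nu> a) / (y - a)) \<longlongrightarrow> 0) (at a)"
    using assms(2) by (simp add: \<nu>_def has_field_derivative_iff)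
  then have "((\<lambda>y. (\<nu> y - \<nu> a) / (y - a)) \<longlongrightarrow> 0) (at a)"
    by (rule Lim_null_comparison[rotated, OF tendsto_rabs_zero])
      (use le in \<open>auto simp: abs_divide intro!: always_eventually divide_right_mono\<close>)
  then have "(\<nu> has_real_derivative 0) (at a)"
    by (simp add: has_field_derivative_iff)
  then have "((\<lambda>x. \<nu> x + c * x) has_real_derivative c) (at a)"
    by (auto intro!: derivative_eq_intros)
  then show ?thesis by (simp add: \<nu>_def)
qed

section \<open>Decreasing functions of the distance to a point\<close>

lemma borel_measurable_antitone_dist:
  fixes h :: "real \<Rightarrow> real"
  assumes "\<And>s t. 0 \<le> s \<Longrightarrow> s \<le> t \<Longrightarrow> h t \<le> h s"
  shows "(\<lambda>t. h \<bar>t - a\<bar>) \<in> borel_measurable borel"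
proof -
  have "mono (\<lambda>s. - h (max s 0))" using assms by (auto simp: mono_def)
  then have [measurable]: "(\<lambda>s. - h (max s 0)) \<in> borel_measurable borel" by (rule borel_measurable_mono)
  have "(\<lambda>t. - (- h (max \<bar>t - a\<bar> 0))) \<in> borel_measurable borel" by measurable
  then show ?thesis by simp
qed

text \<open>
  Tonelli for the region below the graph of \<open>t \<mapsto> h |t - a|\<close>.
\<close>
lemma nn_integral_dist_layer_cake:
  fixes h :: "real \<Rightarrow> real"
  assumes h: "\<And>s t. 0 \<le> s \<Longrightarrow> s \<le> t \<Longrightarrow> h t \<le> h s"
    and M: "sigma_finite_measure M" and sets_M [simp, measurable_cong]: "sets M = sets borel"
  shows "(\<integral>\<^sup>+t\<in>{a-\<delta>..a+\<delta>}. ennreal (h \<bar>t - a\<bar>) \<partial>M) =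
    (\<integral>\<^sup>+y. emeasure M {t\<in>{a-\<delta>..a+\<delta>}. 0 \<le> y \<and> y < h \<bar>t - a\<bar>} \<partial>lborel)"
proof -
  note [measurable] = borel_measurable_antitone_dist[of h a, OF h]
  interpret M: sigma_finite_measure M by fact
  interpret P: pair_sigma_finite M "lborel :: real measure"
    unfolding pair_sigma_finite_def using M lborel.sigma_finite_measure_axioms by blast
  let ?g = "\<lambda>t y. indicator {p. fst p \<in> {a-\<delta>..a+\<delta>} \<and> 0 \<le> snd p \<and> snd p < h \<bar>fst p - a\<bar>} (t, y) :: ennreal"
  have space_M: "space M = UNIV"
    using sets_eq_imp_space_eq[OF sets_M] by simp
  have meas: "(\<lambda>(t, y). ?g t y) \<in> borel_measurable (M \<Otimes>\<^sub>M lborel)"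
    unfolding split_beta' by measurable
  have "(\<integral>\<^sup>+t\<in>{a-\<delta>..a+\<delta>}. ennreal (h \<bar>t - a\<bar>) \<partial>M) = (\<integral>\<^sup>+t. \<integral>\<^sup>+y. ?g t y \<partial>lborel \<partial>M)"
  proof (intro nn_integral_cong)
    fix t
    have "(\<integral>\<^sup>+y. ?g t y \<partial>lborel) = (\<integral>\<^sup>+y. indicator {0..<h \<bar>t - a\<bar>} y * indicator {a-\<delta>..a+\<delta>} t \<partial>lborel)"
      by (intro nn_integral_cong) (auto simp: indicator_def)
    also have "\<dots> = ennreal (h \<bar>t - a\<bar>) * indicator {a-\<delta>..a+\<delta>} t"
      by (cases "0 \<le> h \<bar>t - a\<bar>") (auto simp: nn_integral_multc ennreal_neg)
    finally show "ennreal (h \<bar>t - a\<bar>) * indicator {a-\<delta>..a+\<delta>} t = (\<integral>\<^sup>+y. ?g t y \<partial>lborel)" ..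
  qed
  also have "\<dots> = (\<integral>\<^sup>+y. \<integral>\<^sup>+t. ?g t y \<partial>M \<partial>lborel)"
    by (rule P.Fubini'[OF meas, symmetric])
  also have "\<dots> = (\<integral>\<^sup>+y. emeasure M {t\<in>{a-\<delta>..a+\<delta>}. 0 \<le> y \<and> y < h \<bar>t - a\<bar>} \<partial>lborel)"
  proof (intro nn_integral_cong)
    fix y :: real
    have [measurable]: "{t\<in>{a-\<delta>..a+\<delta>}. 0 \<le> y \<and> y < h \<bar>t - a\<bar>} \<in> sets M"
      by simp
    have "(\<integral>\<^sup>+t. ?g t y \<partial>M) = (\<integral>\<^sup>+t. indicator {t\<in>{a-\<delta>..a+\<delta>}. 0 \<le> y \<and> y < h \<bar>t - a\<bar>} t \<partial>M)"
      by (intro nn_integral_cong) (auto simp: indicator_def)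
    then show "(\<integral>\<^sup>+t. ?g t y \<partial>M) = emeasure M {t\<in>{a-\<delta>..a+\<delta>}. 0 \<le> y \<and> y < h \<bar>t - a\<bar>}"
      by simp
  qed
  finally show ?thesis .
qed

text \<open>
  By the layer cake formula it suffices to compare the superlevel sets of the two functions. As
  \<open>h\<close> is decreasing these are centred intervals, open or closed, of a common radius, and for them the
  comparison is the hypothesis on balls.
\<close>
lemma nn_integral_antitone_dist_le:
  fixes h :: "real \<Rightarrow> real"
  assumes h: "\<And>s t. 0 \<le> s \<Longrightarrow> s \<le> t \<Longrightarrow> h t \<le> h s"
    and M: "sigma_finite_measure M" and sets_M [simp, measurable_cong]: "sets M = sets borel"
    and "0 \<le> \<epsilon>"
    and ball: "\<And>s. 0 \<le> s \<Longrightarrow> s \<le> \<delta> \<Longrightarrow> emeasure M {a-s..a+s} \<le> ennreal (\<epsilon> * (2 * s))"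
  shows "(\<integral>\<^sup>+t\<in>{a-\<delta>..a+\<delta>}. ennreal (h \<bar>t - a\<bar>) \<partial>M) \<le>
    ennreal \<epsilon> * (\<integral>\<^sup>+u\<in>{-\<delta>..\<delta>}. ennreal (h \<bar>u\<bar>) \<partial>lborel)"
proof -
  let ?A = "\<lambda>a y. {t\<in>{a-\<delta>..a+\<delta>}. 0 \<le> y \<and> y < h \<bar>t - a\<bar>}"
  have A_sets [simp]: "?A a y \<in> sets borel" for a y
  proof -
    note [measurable] = borel_measurable_antitone_dist[of h a, OF h]
    show ?thesis by simp
  qed
  have A_le: "emeasure M (?A a y) \<le> ennreal \<epsilon> * emeasure lborel (?A 0 y)" for y
  proof (cases "?A a y = {}")
    case False
    define S where "S = {s\<in>{0..\<delta>}. y < h s}"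
    from False obtain t where t: "t \<in> ?A a y" by blast
    have S: "\<bar>t - a\<bar> \<in> S" if "t \<in> ?A a y" for t using that by (auto simp: S_def)
    have bdd: "bdd_above S" by (auto simp: S_def intro!: bdd_aboveI[of _ \<delta>])
    have ne: "S \<noteq> {}" using S[OF t] by auto
    \<comment> \<open>The superlevel set around \<open>a\<close> lies in the closed interval of radius \<open>Sup S\<close>; the one around \<open>0\<close>
      contains the open interval of the same radius, of equal Lebesgue measure.\<close>
    let ?s = "Sup S"
    have s: "0 \<le> ?s" "?s \<le> \<delta>"
      using cSup_upper[OF S[OF t] bdd] cSup_least[OF ne, of \<delta>] by (auto simp: S_def)
    have "emeasure M (?A a y) \<le> emeasure M {a-?s..a+?s}"
      using cSup_upper[OF S bdd] by (intro emeasure_mono) (auto simp: abs_le_iff algebra_simps)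
    also have "\<dots> \<le> ennreal (\<epsilon> * (2 * ?s))" by (rule ball[OF s])
    also have "\<dots> = ennreal \<epsilon> * emeasure lborel {-?s<..<?s}"
      using s \<open>0 \<le> \<epsilon>\<close> by (simp add: ennreal_mult)
    also have "\<dots> \<le> ennreal \<epsilon> * emeasure lborel (?A 0 y)"
    proof (intro mult_left_mono emeasure_mono subsetI)
      fix u assume "u \<in> {-?s<..<?s}"
      then have "\<bar>u\<bar> < ?s" by auto
      then obtain v where v: "v \<in> S" "\<bar>u\<bar> < v" using less_cSup_iff[OF ne bdd] by auto
      then have "y < h \<bar>u\<bar>" using h[of "\<bar>u\<bar>" v] by (auto simp: S_def)
      moreover have "\<bar>u\<bar> \<le> \<delta>" "0 \<le> y" using t v by (simp_all add: S_def)
      ultimately show "u \<in> ?A 0 y" by (simp add: abs_le_iff)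
    next
      show "?A 0 y \<in> sets lborel" using A_sets[of 0 y] by (simp only: sets_lborel)
    qed (rule zero_le)
    finally show ?thesis .
  qed (simp only: emeasure_empty zero_le)
  have meas: "(\<lambda>y. emeasure lborel (?A 0 y)) \<in> borel_measurable lborel"
  proof -
    note [measurable] = borel_measurable_antitone_dist[of h 0, OF h]
    have "{p \<in> space (lborel \<Otimes>\<^sub>M lborel). snd p \<in> ?A 0 (fst p)} \<in> sets (lborel \<Otimes>\<^sub>M lborel)"
      by measurable
    then show ?thesis by (rule lborel.measurable_emeasure[rotated]) (simp only: space_lborel space_borel subset_UNIV)
  qed
  have "(\<integral>\<^sup>+t\<in>{a-\<delta>..a+\<delta>}. ennreal (h \<bar>t - a\<bar>) \<partial>M) = (\<integral>\<^sup>+y. emeasure M (?A a y) \<partial>lborel)"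
    by (rule nn_integral_dist_layer_cake[OF h M sets_M])
  also have "\<dots> \<le> (\<integral>\<^sup>+y. ennreal \<epsilon> * emeasure lborel (?A 0 y) \<partial>lborel)"
    by (intro nn_integral_mono A_le)
  also have "\<dots> = ennreal \<epsilon> * (\<integral>\<^sup>+y. emeasure lborel (?A 0 y) \<partial>lborel)"
    by (rule nn_integral_cmult[OF meas])
  also have "(\<integral>\<^sup>+y. emeasure lborel (?A 0 y) \<partial>lborel) = (\<integral>\<^sup>+u\<in>{0-\<delta>..0+\<delta>}. ennreal (h \<bar>u - 0\<bar>) \<partial>lborel)"
    by (rule nn_integral_dist_layer_cake[OF h lborel.sigma_finite_measure_axioms, symmetric]) auto
  finally show ?thesis by simp
qed

text \<open>
  A vanishing derivative of \<open>W\<close> at \<open>a\<close> bounds the increments of \<open>W\<close> across \<open>a\<close>, hence the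
  masses of small centred intervals. The endpoints may carry mass, so the interval is enlarged to
  radius \<open>s' > s\<close> and then \<open>s'\<close> tends to \<open>s\<close>. For \<open>s = 0\<close> it follows that \<open>a\<close> is not an atom.
\<close>
lemma stieltjes_measure_ball_le:
  assumes W: "mono W" and deriv: "(W has_real_derivative 0) (at a)" and "0 < \<epsilon>"
  obtains \<delta> where "0 < \<delta>"
    "\<And>s. 0 \<le> s \<Longrightarrow> s \<le> \<delta> \<Longrightarrow> emeasure (stieltjes_measure W) {a-s..a+s} \<le> ennreal (\<epsilon> * (2 * s))"
proof -
  have "((\<lambda>y. (W y - W a) / (y - a)) \<longlongrightarrow> 0) (at a)"
    using deriv by (simp add: has_field_derivative_iff)
  from tendstoD[OF this \<open>0 < \<epsilon>\<close>] obtain d where d: "0 < d"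
    "\<And>y. y \<noteq> a \<Longrightarrow> \<bar>y - a\<bar> < d \<Longrightarrow> \<bar>(W y - W a) / (y - a)\<bar> < \<epsilon>"
    unfolding eventually_at by (auto simp: dist_real_def)
  have incr: "\<bar>W y - W a\<bar> \<le> \<epsilon> * \<bar>y - a\<bar>" if "\<bar>y - a\<bar> < d" for y
    using d(2)[OF _ that] by (cases "y = a") (auto simp: field_simps abs_divide)
  show ?thesis
  proof (rule that[of "d / 2"])
    fix s assume s: "0 \<le> s" "s \<le> d / 2"
    have le: "emeasure (stieltjes_measure W) {a-s..a+s} \<le> ennreal (\<epsilon> * (2 * s'))" if s': "s < s'" "s' < d" for s'
    proof -
      have "emeasure (stieltjes_measure W) {a-s..a+s} \<le> emeasure (stieltjes_measure W) {a-s'<..a+s}"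
        using s' by (intro emeasure_mono) auto
      also have "\<dots> = ennreal (right_lim_fun W (a + s) - right_lim_fun W (a - s'))"
        using s s' by (intro emeasure_stieltjes_measure_Ioc W) auto
      also have "\<dots> \<le> ennreal (W (a + s') - W (a - s'))"
        using s s' le_right_lim_fun[OF W, of "a - s'" "a - s'"] right_lim_fun_le[OF W, of "a + s" "a + s'"]
        by (intro ennreal_leI) auto
      also have "\<dots> \<le> ennreal (\<epsilon> * (2 * s'))"
        using s s' incr[of "a + s'"] incr[of "a - s'"] by (intro ennreal_leI) auto
      finally show ?thesis .
    qed
    show "emeasure (stieltjes_measure W) {a-s..a+s} \<le> ennreal (\<epsilon> * (2 * s))"
    proof (rule tendsto_lowerbound)
      show "((\<lambda>s'. ennreal (\<epsilon> * (2 * s'))) \<longlongrightarrow> ennreal (\<epsilon> * (2 * s))) (at_right s)"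
        by (intro tendsto_intros)
      show "\<forall>\<^sub>F s' in at_right s. emeasure (stieltjes_measure W) {a-s..a+s} \<le> ennreal (\<epsilon> * (2 * s'))"
        using le s d(1) by (auto simp: eventually_at_right_field intro!: exI[of _ d])
    qed simp
  qed (use d in simp)
qed


section \<open>The kernel and its decreasing majorant\<close>

lemma bdd_above_abs_image: "bounded (range f) \<Longrightarrow> bdd_above ((\<lambda>t. \<bar>f t :: real\<bar>) ` A)"
  by (auto simp: bounded_iff bdd_above_def)

lemma star_fun_upper:
  assumes "bounded (range f)" "\<bar>x\<bar> \<le> \<bar>t\<bar>" "\<bar>t\<bar> \<le> pi"
  shows "\<bar>f t\<bar> \<le> star_fun f x"
  unfolding star_fun_def
  by (rule cSUP_upper) (use assms bdd_above_abs_image in auto)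

lemma star_fun_antitone:
  assumes "bounded (range f)" "\<bar>x\<bar> \<le> \<bar>y\<bar>" "\<bar>y\<bar> \<le> pi"
  shows "star_fun f y \<le> star_fun f x"
  unfolding star_fun_def
  by (rule cSUP_least) (use assms star_fun_upper[OF assms(1)] in \<open>auto simp: star_fun_def\<close>)

lemma star_fun_nonneg:
  assumes "bounded (range f)" "\<bar>x\<bar> \<le> pi" shows "0 \<le> star_fun f x"
  using star_fun_upper[OF assms(1), of x pi] assms(2) by (simp add: order_trans[OF abs_ge_zero])

lemma sup_norm_upper:
  assumes "bounded (range f)" shows "\<bar>f t\<bar> \<le> sup_norm f"
  unfolding sup_norm_def
  by (rule cSUP_upper) (use assms bdd_above_abs_image in auto)

lemma star_fun_le_sup_norm:
  assumes "bounded (range f)" "\<bar>x\<bar> \<le> pi" shows "star_fun f x \<le> sup_norm f"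
  unfolding star_fun_def
  by (rule cSUP_least) (use assms sup_norm_upper[OF assms(1)] in \<open>auto intro!: exI[of _ pi]\<close>)

text \<open>
  The majorant \<open>h\<close> is \<open>\<parallel>f\<parallel>\<close> on an interval of length \<open>4 l\<close>, and beyond it \<open>f\<^sup>*\<close> at half
  the distance, which costs a factor \<open>2\<close> on substituting \<open>u = 2 v\<close>. The truncation \<open>min (s / 2) pi\<close>
  makes \<open>h\<close> decreasing on the whole half-line, as \<^const>\<open>star_fun\<close> is the supremum of an empty set
  beyond \<open>pi\<close>.
\<close>
lemma nn_integral_star_fun_half_le:
  assumes f: "bounded (range f)" and "0 \<le> l" "\<delta> \<le> pi"
  defines "h \<equiv> \<lambda>s. if s \<le> 2 * l then sup_norm f else star_fun f (min (s / 2) pi)"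
  shows "(\<integral>\<^sup>+u\<in>{-\<delta>..\<delta>}. ennreal (h \<bar>u\<bar>) \<partial>lborel) \<le>
    ennreal (4 * l * sup_norm f) + 2 * (\<integral>\<^sup>+t\<in>{-pi..pi}. ennreal (star_fun f t) \<partial>lborel)"
proof -
  let ?k = "\<lambda>s. star_fun f (min (s / 2) pi)"
  have "?k t \<le> ?k s" if "0 \<le> s" "s \<le> t" for s t
    using that by (intro star_fun_antitone f) (auto simp: min_def)
  from borel_measurable_antitone_dist[of ?k 0, OF this]
  have [measurable]: "(\<lambda>u. ?k \<bar>u\<bar>) \<in> borel_measurable borel" by simp
  have N: "0 \<le> sup_norm f" using sup_norm_upper[OF f, of 0] by simp
  have "(\<integral>\<^sup>+u\<in>{-\<delta>..\<delta>}. ennreal (h \<bar>u\<bar>) \<partial>lborel) \<le>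
    (\<integral>\<^sup>+u. ennreal (sup_norm f) * indicator {-2 * l..2 * l} u + ennreal (?k \<bar>u\<bar>) * indicator {-\<delta>..\<delta>} u \<partial>lborel)"
    by (intro nn_integral_mono) (auto simp: h_def indicator_def)
  also have "\<dots> = (\<integral>\<^sup>+u. ennreal (sup_norm f) * indicator {-2 * l..2 * l} u \<partial>lborel) +
      (\<integral>\<^sup>+u. ennreal (?k \<bar>u\<bar>) * indicator {-\<delta>..\<delta>} u \<partial>lborel)"
    by (rule nn_integral_add) measurable
  also have "(\<integral>\<^sup>+u. ennreal (sup_norm f) * indicator {-2 * l..2 * l} u \<partial>lborel) = ennreal (4 * l * sup_norm f)"
    using \<open>0 \<le> l\<close> N by (simp add: nn_integral_cmult ennreal_mult[symmetric] mult_ac)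
  also have "(\<integral>\<^sup>+u. ennreal (?k \<bar>u\<bar>) * indicator {-\<delta>..\<delta>} u \<partial>lborel) =
      2 * (\<integral>\<^sup>+v. ennreal (?k \<bar>2 * v\<bar>) * indicator {-\<delta>..\<delta>} (2 * v) \<partial>lborel)"
    by (subst nn_integral_real_affine[where c=2 and t=0]) auto
  also have "(\<integral>\<^sup>+v. ennreal (?k \<bar>2 * v\<bar>) * indicator {-\<delta>..\<delta>} (2 * v) \<partial>lborel) \<le>
      (\<integral>\<^sup>+t\<in>{-pi..pi}. ennreal (star_fun f t) \<partial>lborel)"
  proof (intro nn_integral_mono)
    fix v :: real
    show "ennreal (?k \<bar>2 * v\<bar>) * indicator {-\<delta>..\<delta>} (2 * v) \<le> ennreal (star_fun f v) * indicator {-pi..pi} v"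
    proof (cases "\<bar>2 * v\<bar> \<le> \<delta>")
      case True
      then have v: "\<bar>v\<bar> \<le> pi" using \<open>\<delta> \<le> pi\<close> by auto
      then have "?k \<bar>2 * v\<bar> = star_fun f v" by (simp add: star_fun_def abs_mult)
      moreover have "v \<in> {-pi..pi}" using v by (auto simp: abs_le_iff)
      ultimately show ?thesis by (auto simp: indicator_def)
    next
      case False
      then have "2 * v \<notin> {-\<delta>..\<delta>}" by auto
      then show ?thesis by simp
    qed
  qed
  finally show ?thesis by (simp add: add_left_mono mult_left_mono)
qed

text \<open>
  If \<open>|t - a| \<ge> 2 l\<close> then moving the centre from \<open>a\<close> to \<open>x\<close> at most halves the distance to \<open>t\<close>. Far
  from \<open>a\<close> the difference \<open>x - t\<close> may leave \<open>[-pi, pi]\<close>, by at most \<open>l\<close>; its representative there is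
  then at distance at least \<open>pi - l \<ge> \<delta> / 2\<close> from \<open>0\<close>.
\<close>
lemma abs_kernel_le:
  assumes f: "torus_periodic f" "bounded (range f)"
    and \<delta>: "0 < \<delta>" "\<delta> \<le> pi / 2" and l: "0 \<le> l" "l \<le> \<delta> / 2" and x: "\<bar>x - a\<bar> \<le> l" and t: "\<bar>t - a\<bar> \<le> pi"
  shows "\<bar>f (x - t)\<bar> \<le> (if \<bar>t - a\<bar> \<le> 2 * l then sup_norm f
    else if \<bar>t - a\<bar> \<le> \<delta> then star_fun f (\<bar>t - a\<bar> / 2) else star_fun f (\<delta> / 2))"
proof -
  have per: "f (y + 2 * pi) = f y" for y using f(1) by (simp add: torus_periodic_def)
  have tri: "\<bar>t - a\<bar> - l \<le> \<bar>x - t\<bar>" "\<bar>x - t\<bar> \<le> \<bar>t - a\<bar> + l" using x by linarith+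
  consider "\<bar>t - a\<bar> \<le> 2 * l" | "2 * l < \<bar>t - a\<bar>" "\<bar>t - a\<bar> \<le> \<delta>" | "2 * l < \<bar>t - a\<bar>" "\<delta> < \<bar>t - a\<bar>"
    by linarith
  then show ?thesis
  proof cases
    case 1
    then show ?thesis using sup_norm_upper[OF f(2)] by simp
  next
    case 2
    define d where "d = \<bar>t - a\<bar>"
    have "0 \<le> d / 2" "d / 2 \<le> \<bar>x - t\<bar>" "\<bar>x - t\<bar> \<le> pi"
      using 2 tri \<delta> l unfolding d_def[symmetric] by linarith+
    then have "\<bar>f (x - t)\<bar> \<le> star_fun f (d / 2)"
      by (intro star_fun_upper f(2)) (simp_all only: abs_of_nonneg)
    then show ?thesis using 2 by (simp add: d_def)
  next
    case 3
    have "\<exists>y. f (x - t) = f y \<and> \<delta> / 2 \<le> \<bar>y\<bar> \<and> \<bar>y\<bar> \<le> pi"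
    proof -
      consider "\<bar>x - t\<bar> \<le> pi" | "x - t > pi" | "x - t < - pi" by linarith
      then show ?thesis
      proof cases
        case 1
        then have "\<delta> / 2 \<le> \<bar>x - t\<bar> \<and> \<bar>x - t\<bar> \<le> pi" using 3 tri l by linarith
        then show ?thesis by blast
      next
        case 2
        have "f (x - t) = f (x - t - 2 * pi)" using per[of "x - t - 2 * pi"] by simp
        moreover have "\<delta> / 2 \<le> \<bar>x - t - 2 * pi\<bar> \<and> \<bar>x - t - 2 * pi\<bar> \<le> pi"
          using 2 tri \<delta> l t by linarith
        ultimately show ?thesis by blast
      next
        case 3
        have "f (x - t) = f (x - t + 2 * pi)" using per[of "x - t"] by simp
        moreover have "\<delta> / 2 \<le> \<bar>x - t + 2 * pi\<bar> \<and> \<bar>x - t + 2 * pi\<bar> \<le> pi"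
          using 3 tri \<delta> l t by linarith
        ultimately show ?thesis by blast
      qed
    qed
    then obtain y where y: "f (x - t) = f y" "\<delta> / 2 \<le> \<bar>y\<bar>" "\<bar>y\<bar> \<le> pi" by blast
    have "\<bar>f (x - t)\<bar> \<le> star_fun f (\<delta> / 2)"
      unfolding y(1) using y(2,3) \<delta>(1) by (intro star_fun_upper f(2)) auto
    then show ?thesis using 3 by simp
  qed
qed

text \<open>
  Within distance \<open>\<delta>\<close> of \<open>a\<close> the kernel is below a decreasing function of the distance, whose
  integral is compared with a Lebesgue integral; beyond, the kernel is uniformly small.
\<close>
lemma nn_integral_abs_kernel_le:
  assumes f: "torus_periodic f" "bounded (range f)"
    and \<delta>: "0 < \<delta>" "\<delta> \<le> pi / 2" and l: "0 \<le> l" "l \<le> \<delta> / 2" and x: "\<bar>x - a\<bar> \<le> l" and "0 \<le> \<epsilon>"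
    and M: "sigma_finite_measure M" and sets_M [measurable_cong]: "sets M = sets borel"
    and ball: "\<And>s. 0 \<le> s \<Longrightarrow> s \<le> \<delta> \<Longrightarrow> emeasure M {a-s..a+s} \<le> ennreal (\<epsilon> * (2 * s))"
  shows "(\<integral>\<^sup>+t\<in>{a-pi<..a+pi}. ennreal \<bar>f (x - t)\<bar> \<partial>M) \<le>
    ennreal \<epsilon> * (ennreal (4 * l * sup_norm f) + 2 * (\<integral>\<^sup>+t\<in>{-pi..pi}. ennreal (star_fun f t) \<partial>lborel)) +
    ennreal (star_fun f (\<delta> / 2)) * emeasure M {a-pi<..a+pi}"
proof -
  define h where "h = (\<lambda>s. if s \<le> 2 * l then sup_norm f else star_fun f (min (s / 2) pi))"
  have h: "h t \<le> h s" if "0 \<le> s" "s \<le> t" for s t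
    using that star_fun_le_sup_norm[OF f(2), of "min (t / 2) pi"]
      star_fun_antitone[OF f(2), of "min (s / 2) pi" "min (t / 2) pi"]
    by (auto simp: h_def min_def)
  have [measurable]: "(\<lambda>t. h \<bar>t - a\<bar>) \<in> borel_measurable borel"
    by (rule borel_measurable_antitone_dist[of h a, OF h])
  have "(\<integral>\<^sup>+t\<in>{a-pi<..a+pi}. ennreal \<bar>f (x - t)\<bar> \<partial>M) \<le>
    (\<integral>\<^sup>+t. ennreal (h \<bar>t - a\<bar>) * indicator {a-\<delta>..a+\<delta>} t +
      ennreal (star_fun f (\<delta> / 2)) * indicator {a-pi<..a+pi} t \<partial>M)"
  proof (intro nn_integral_mono)
    fix t
    show "ennreal \<bar>f (x - t)\<bar> * indicator {a-pi<..a+pi} t \<le> ennreal (h \<bar>t - a\<bar>) * indicator {a-\<delta>..a+\<delta>} t +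
      ennreal (star_fun f (\<delta> / 2)) * indicator {a-pi<..a+pi} t"
    proof (cases "t \<in> {a-pi<..a+pi}")
      case True
      then have t: "\<bar>t - a\<bar> \<le> pi" by auto
      note le = abs_kernel_le[OF f \<delta> l x t]
      show ?thesis
      proof (cases "\<bar>t - a\<bar> \<le> \<delta>")
        case near: True
        then have "t \<in> {a-\<delta>..a+\<delta>}" by auto
        moreover have "\<bar>f (x - t)\<bar> \<le> h \<bar>t - a\<bar>"
          using le near t by (auto simp: h_def min_def split: if_splits)
        ultimately show ?thesis using True by (auto intro!: add_increasing2 ennreal_leI)
      next
        case False
        then have "\<bar>f (x - t)\<bar> \<le> star_fun f (\<delta> / 2)"
          using le l by auto
        then show ?thesis using True by (auto intro!: add_increasing ennreal_leI)
      qed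
    qed simp
  qed
  also have "\<dots> = (\<integral>\<^sup>+t\<in>{a-\<delta>..a+\<delta>}. ennreal (h \<bar>t - a\<bar>) \<partial>M) +
      (\<integral>\<^sup>+t. ennreal (star_fun f (\<delta> / 2)) * indicator {a-pi<..a+pi} t \<partial>M)"
    by (rule nn_integral_add) measurable
  also have "(\<integral>\<^sup>+t. ennreal (star_fun f (\<delta> / 2)) * indicator {a-pi<..a+pi} t \<partial>M) =
      ennreal (star_fun f (\<delta> / 2)) * emeasure M {a-pi<..a+pi}"
    by (subst nn_integral_cmult_indicator) (simp_all add: sets_M)
  also have "(\<integral>\<^sup>+t\<in>{a-\<delta>..a+\<delta>}. ennreal (h \<bar>t - a\<bar>) \<partial>M) \<le>
      ennreal \<epsilon> * (\<integral>\<^sup>+u\<in>{-\<delta>..\<delta>}. ennreal (h \<bar>u\<bar>) \<partial>lborel)"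
    by (rule nn_integral_antitone_dist_le[OF h M sets_M \<open>0 \<le> \<epsilon>\<close> ball])
  also have "(\<integral>\<^sup>+u\<in>{-\<delta>..\<delta>}. ennreal (h \<bar>u\<bar>) \<partial>lborel) \<le>
      ennreal (4 * l * sup_norm f) + 2 * (\<integral>\<^sup>+t\<in>{-pi..pi}. ennreal (star_fun f t) \<partial>lborel)"
    unfolding h_def by (rule nn_integral_star_fun_half_le[OF f(2) l(1)]) (use \<delta> in auto)
  finally show ?thesis by (simp add: add_right_mono mult_left_mono)
qed


section \<open>Stieltjes integrals over the torus\<close>

lemma pos_measure_eq: "pos_measure \<mu> = stieltjes_measure (\<lambda>x. (variation_fun \<mu> x + \<mu> x) / 2)"
  by (simp add: pos_measure_def stieltjes_measure_def)

lemma neg_measure_eq: "neg_measure \<mu> = stieltjes_measure (\<lambda>x. (variation_fun \<mu> x - \<mu> x) / 2)"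
  by (simp add: neg_measure_def stieltjes_measure_def)

lemma set_integral_stieltjes_measure_linear:
  fixes f :: "real \<Rightarrow> real"
  assumes "0 \<le> k" and [measurable]: "f \<in> borel_measurable borel"
  shows "(LINT t:{a<..b}|stieltjes_measure (\<lambda>x. k * x). f t) = k * (LINT t:{a<..b}|lborel. f t)"
  unfolding stieltjes_measure_linear[OF assms(1)] set_lebesgue_integral_def
  using assms(1) by (subst integral_density) (auto simp: integral_mult_right_zero)

text \<open>
  The positive and negative variations of \<open>\<mu>\<close> need not be those of \<open>\<mu> x - c x\<close> plus linear
  functions. But moving the terms with a negative sign to the other side gives an identity between sums of
  monotone functions, in which \<open>c = p - q\<close> is split into its positive and negative parts.
\<close>
lemma torus_stieltjes_integral_minus_linear:
  assumes \<mu>: "BV_torus \<mu>" and f [measurable]: "f \<in> borel_measurable borel" "bounded (range f)"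
  shows "torus_stieltjes_integral f \<mu> =
    c * (LINT t:{-pi<..pi}|lborel. f t) + torus_stieltjes_integral f (\<lambda>x. \<mu> x - c * x)"
proof -
  define \<nu> where "\<nu> = (\<lambda>x. \<mu> x - c * x)"
  define p q where "p = max c 0" and "q = max (- c) 0"
  have pq: "0 \<le> p" "0 \<le> q" "c = p - q" by (auto simp: p_def q_def)
  have \<nu>: "BV_torus \<nu>" unfolding \<nu>_def by (rule BV_torus_minus_linear[OF \<mu>])
  note mono = mono_variation_fun(2,3)[OF \<mu>] mono_variation_fun(2,3)[OF \<nu>]
  have lin: "mono (\<lambda>x::real. k * x)" if "0 \<le> k" for k
    using that by (auto simp: mono_def mult_left_mono)
  have add: "mono (\<lambda>x. F x + G x)" if "mono F" "mono G" for F G :: "real \<Rightarrow> real"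
    using that by (auto simp: mono_def intro!: add_mono)
  let ?J = "\<lambda>F. LINT t:{-pi<..pi}|stieltjes_measure F. f t"
  let ?P = "\<lambda>g x. (variation_fun g x + g x) / 2" and ?N = "\<lambda>g x. (variation_fun g x - g x) / 2"
  have "?J (\<lambda>x. ?P \<mu> x + (?N \<nu> x + q * x)) = ?J (\<lambda>x. ?N \<mu> x + (?P \<nu> x + p * x))"
    by (rule arg_cong[where f="?J"]) (auto simp: \<nu>_def pq(3) field_simps)
  then have "?J (?P \<mu>) + (?J (?N \<nu>) + q * (LINT t:{-pi<..pi}|lborel. f t)) =
      ?J (?N \<mu>) + (?J (?P \<nu>) + p * (LINT t:{-pi<..pi}|lborel. f t))"
    using pq(1,2) by (simp add: set_integral_stieltjes_measure_add set_integral_stieltjes_measure_linear mono lin add f)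
  then show ?thesis
    unfolding \<nu>_def[symmetric] torus_stieltjes_integral_def pos_measure_eq neg_measure_eq
    using pq(3) left_diff_distrib[of p q "LINT t:{-pi<..pi}|lborel. f t"] by simp
qed

text \<open>
  The positive and negative variations of \<open>\<nu>\<close> add up to its variation function.
\<close>
lemma abs_torus_stieltjes_integral_le:
  assumes \<nu>: "BV_torus \<nu>" and f [measurable]: "f \<in> borel_measurable borel" "bounded (range f)"
  shows "\<bar>torus_stieltjes_integral f \<nu>\<bar> \<le> (LINT t:{-pi<..pi}|stieltjes_measure (variation_fun \<nu>). \<bar>f t\<bar>)"
proof -
  note mono = mono_variation_fun[OF \<nu>]
  let ?P = "\<lambda>x. (variation_fun \<nu> x + \<nu> x) / 2" and ?N = "\<lambda>x. (variation_fun \<nu> x - \<nu> x) / 2"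
  have abs_f: "(\<lambda>t. \<bar>f t\<bar>) \<in> borel_measurable borel" "bounded (range (\<lambda>t. \<bar>f t\<bar>))"
    using f(2) by (auto simp: bounded_iff)
  have J: "\<bar>LINT t:{-pi<..pi}|stieltjes_measure F. f t\<bar> \<le> (LINT t:{-pi<..pi}|stieltjes_measure F. \<bar>f t\<bar>)" if "mono F" for F
    using set_integral_norm_bound[OF set_integrable_stieltjes_measure[OF that f]] by simp
  have "(\<lambda>x. ?P x + ?N x) = variation_fun \<nu>" by (auto simp: field_simps)
  then have "(LINT t:{-pi<..pi}|stieltjes_measure (variation_fun \<nu>). \<bar>f t\<bar>) =
      (LINT t:{-pi<..pi}|stieltjes_measure ?P. \<bar>f t\<bar>) + (LINT t:{-pi<..pi}|stieltjes_measure ?N. \<bar>f t\<bar>)"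
    using set_integral_stieltjes_measure_add[OF mono(2,3) abs_f, of "- pi" pi] by simp
  then show ?thesis
    unfolding torus_stieltjes_integral_def pos_measure_eq neg_measure_eq
    using J[OF mono(2)] J[OF mono(3)] by linarith
qed

lemma set_integral_lborel_reflect_periodic:
  fixes f :: "real \<Rightarrow> real"
  assumes f: "torus_periodic f" "f \<in> borel_measurable borel" "bounded (range f)"
  shows "(LINT t:{-pi<..pi}|lborel. f (x - t)) = (LBINT t:{-pi..pi}. f t)"
proof -
  note [measurable] = f(2)
  have per: "f (y + 2 * pi) = f y" for y using f(1) by (simp add: torus_periodic_def)
  have per': "f (x - (t + 2 * pi)) = f (x - t)" for t using per[of "x - (t + 2 * pi)"] by simp
  have lborel: "stieltjes_measure (\<lambda>t. 1 * t) = lborel"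
    by (simp only: stieltjes_measure_linear zero_le_one ennreal_1 density_1)
  have "(LINT t:{-pi<..-pi+2*pi}|stieltjes_measure (\<lambda>t. 1 * t). f (x - t)) =
      (LINT t:{x-pi<..x-pi+2*pi}|stieltjes_measure (\<lambda>t. 1 * t). f (x - t))"
    by (rule set_integral_stieltjes_measure_periodic[where D="2 * pi"])
      (use f(3) per' in \<open>auto simp: mono_def bounded_iff\<close>)
  then have "(LINT t:{-pi<..pi}|lborel. f (x - t)) = (LINT t:{x-pi<..x+pi}|lborel. f (x - t))"
    unfolding lborel by (simp add: algebra_simps)
  also have "\<dots> = (\<integral>u. indicator {x-pi<..x+pi} (x - u) * f u \<partial>lborel)"
    unfolding set_lebesgue_integral_def
    by (subst lborel_integral_real_affine[where c="-1" and t=x]) auto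
  also have "\<dots> = (LBINT t:{-pi..pi}. f t)"
    unfolding set_lebesgue_integral_def
  proof (rule integral_cong_AE)
    show "AE u in lborel. indicator {x-pi<..x+pi} (x - u) * f u = indicator {-pi..pi} u *\<^sub>R f u"
      using AE_lborel_singleton[of pi] by eventually_elim (auto simp: indicator_def)
  qed measurable
  finally show ?thesis .
qed

text \<open>
  The period \<open>(-pi, pi]\<close> is first moved to the one centred at \<open>a\<close>, as \<open>a\<close> may lie at or beyond an
  endpoint.
\<close>
lemma abs_torus_stieltjes_kernel_le:
  fixes \<nu> :: "real \<Rightarrow> real" and f :: "real \<Rightarrow> real"
  defines "M \<equiv> stieltjes_measure (variation_fun \<nu>)"
  assumes \<nu>: "BV_torus \<nu>"
    and f: "torus_periodic f" "f \<in> borel_measurable borel" "bounded (range f)"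
    and \<delta>: "0 < \<delta>" "\<delta> \<le> pi / 2" and l: "0 \<le> l" "l \<le> \<delta> / 2" and x: "\<bar>x - a\<bar> \<le> l" and "0 \<le> \<epsilon>"
    and ball: "\<And>s. 0 \<le> s \<Longrightarrow> s \<le> \<delta> \<Longrightarrow> emeasure M {a-s..a+s} \<le> ennreal (\<epsilon> * (2 * s))"
    and C: "(\<integral>\<^sup>+t\<in>{-pi..pi}. ennreal (star_fun f t) \<partial>lborel) \<le> ennreal C" "0 \<le> C"
  shows "\<bar>torus_stieltjes_integral (\<lambda>t. f (x - t)) \<nu>\<bar> \<le>
    \<epsilon> * (4 * l * sup_norm f + 2 * C) + star_fun f (\<delta> / 2) * measure M {a-pi<..a+pi}"
proof -
  note [measurable] = f(2)
  note mono = mono_variation_fun(1)[OF \<nu>]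
  let ?g = "\<lambda>t. \<bar>f (x - t)\<bar>"
  have per: "f (y + 2 * pi) = f y" for y using f(1) by (simp add: torus_periodic_def)
  have per': "?g (t + 2 * pi) = ?g t" for t using per[of "x - (t + 2 * pi)"] by simp
  have g: "?g \<in> borel_measurable borel" "bounded (range ?g)" using f(3) by (auto simp: bounded_iff)
  have fin: "emeasure M {a-pi<..a+pi} = ennreal (measure M {a-pi<..a+pi})"
    unfolding M_def by (rule emeasure_eq_ennreal_measure) (simp add: emeasure_stieltjes_measure_Ioc[OF mono])
  have N: "0 \<le> sup_norm f" using sup_norm_upper[OF f(3), of 0] by simp
  have S: "0 \<le> star_fun f (\<delta> / 2)" using \<delta> by (intro star_fun_nonneg f(3)) auto
  have "\<bar>torus_stieltjes_integral (\<lambda>t. f (x - t)) \<nu>\<bar> \<le> (LINT t:{-pi<..pi}|M. ?g t)"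
    unfolding M_def by (rule abs_torus_stieltjes_integral_le[OF \<nu>]) (use f(3) in \<open>auto simp: bounded_iff\<close>)
  also have "\<dots> = (LINT t:{a-pi<..a+pi}|M. ?g t)"
    using set_integral_stieltjes_measure_periodic[OF mono variation_fun_quasiperiodic[OF \<nu>] _ g per', of "-pi" "a - pi"]
    by (simp add: M_def algebra_simps)
  also have "\<dots> \<le> \<epsilon> * (4 * l * sup_norm f + 2 * C) + star_fun f (\<delta> / 2) * measure M {a-pi<..a+pi}"
  proof -
    have "ennreal (LINT t:{a-pi<..a+pi}|M. ?g t) = (\<integral>\<^sup>+t. ennreal (indicator {a-pi<..a+pi} t * ?g t) \<partial>M)"
      unfolding set_lebesgue_integral_def real_scaleR_def
      using set_integrable_stieltjes_measure[OF mono g, of "a - pi" "a + pi"]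
      by (intro nn_integral_eq_integral[symmetric]) (auto simp: set_integrable_def M_def)
    also have "\<dots> = (\<integral>\<^sup>+t\<in>{a-pi<..a+pi}. ennreal (?g t) \<partial>M)"
      by (intro nn_integral_cong) (auto simp: indicator_def)
    also have "\<dots> \<le> ennreal \<epsilon> * (ennreal (4 * l * sup_norm f) + 2 * (\<integral>\<^sup>+t\<in>{-pi..pi}. ennreal (star_fun f t) \<partial>lborel)) +
      ennreal (star_fun f (\<delta> / 2)) * emeasure M {a-pi<..a+pi}"
      by (rule nn_integral_abs_kernel_le[OF f(1,3) \<delta> l x \<open>0 \<le> \<epsilon>\<close> _ _ ball])
        (auto simp: M_def intro: sigma_finite_stieltjes_measure mono)
    also have "\<dots> \<le> ennreal \<epsilon> * (ennreal (4 * l * sup_norm f) + 2 * ennreal C) +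
      ennreal (star_fun f (\<delta> / 2)) * emeasure M {a-pi<..a+pi}"
      by (intro add_mono mult_left_mono C) auto
    also have "\<dots> = ennreal (\<epsilon> * (4 * l * sup_norm f + 2 * C) + star_fun f (\<delta> / 2) * measure M {a-pi<..a+pi})"
      using \<open>0 \<le> \<epsilon>\<close> l(1) N S C(2) unfolding fin
      by (simp add: ennreal_mult)
    finally show ?thesis
      by (subst (asm) ennreal_le_iff) (use \<open>0 \<le> \<epsilon>\<close> l(1) N S C(2) in auto)
  qed
  finally show ?thesis .
qed

section \<open>Convergence at points of strong differentiability\<close>

text \<open>
  Nonnegativity of \<open>lam r\<close> keeps the supremum from ranging over the empty set, where it would be
  \<open>-\<infinity>\<close>.
\<close>
lemma region_limitI:
  assumes lam: "\<forall>\<^sub>F r in at_left 1. 0 \<le> lam r"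
    and ev: "\<And>e. 0 < e \<Longrightarrow> \<forall>\<^sub>F r in at_left 1. \<forall>\<theta>. \<bar>\<theta> - x\<bar> \<le> lam r \<longrightarrow> \<bar>F r \<theta> - A\<bar> \<le> e"
  shows "region_limit F lam x A"
  unfolding region_limit_def
proof (rule order_tendstoI)
  fix b :: ereal assume b: "b < 0"
  show "\<forall>\<^sub>F r in at_left 1. b < (SUP \<theta>\<in>{x - lam r .. x + lam r}. ereal \<bar>F r \<theta> - A\<bar>)"
    using lam
  proof eventually_elim
    case (elim r)
    have "b < ereal \<bar>F r x - A\<bar>" using b by (rule less_le_trans) simp
    also have "\<dots> \<le> (SUP \<theta>\<in>{x - lam r .. x + lam r}. ereal \<bar>F r \<theta> - A\<bar>)"
      by (rule SUP_upper) (use elim in auto)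
    finally show ?case .
  qed
next
  fix b :: ereal assume "0 < b"
  then obtain e where e: "0 < ereal e" "ereal e < b" using ereal_dense2 by blast
  then have "0 < e" by simp
  from ev[OF this] show "\<forall>\<^sub>F r in at_left 1. (SUP \<theta>\<in>{x - lam r .. x + lam r}. ereal \<bar>F r \<theta> - A\<bar>) < b"
  proof eventually_elim
    case (elim r)
    have "(SUP \<theta>\<in>{x - lam r .. x + lam r}. ereal \<bar>F r \<theta> - A\<bar>) \<le> ereal e"
      using elim by (intro SUP_least) (auto simp: abs_le_iff)
    then show ?case using e(2) by (rule le_less_trans)
  qed
qed

theorem theorem1p2:
  fixes \<phi> :: "real \<Rightarrow> real \<Rightarrow> real" and lam :: "real \<Rightarrow> real"
    and \<mu> :: "real \<Rightarrow> real" and x\<^sub>0 :: real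
  assumes "approximate_identity \<phi>"
    and "\<And>r. 0 < r \<Longrightarrow> r < 1 \<Longrightarrow> 0 < lam r"
    and "(lam \<longlongrightarrow> 0) (at_left 1)"
    and "Pi_const lam \<phi> < \<infinity>"
    and "BV_torus \<mu>"
    and "strong_differentiable_at \<mu> x\<^sub>0"
  shows "region_limit (\<lambda>r x. Phi \<phi> r x \<mu>) lam x\<^sub>0 (deriv \<mu> x\<^sub>0)"
proof -
  have \<phi>: "torus_periodic (\<phi> r)" "\<phi> r \<in> borel_measurable borel" "bounded (range (\<phi> r))"
    if "0 < r" "r < 1" for r
    using assms(1) that by (auto simp: approximate_identity_def)
  have mass: "((\<lambda>r. LBINT t:{-pi..pi}. \<phi> r t) \<longlongrightarrow> 1) (at_left 1)"
    and star: "((\<lambda>r. star_fun (\<phi> r) x) \<longlongrightarrow> 0) (at_left 1)" if "0 < x" "x \<le> pi" for x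
    using assms(1) that by (auto simp: approximate_identity_def)
  obtain C where C: "0 \<le> C"
    "\<And>r. 0 < r \<Longrightarrow> r < 1 \<Longrightarrow> (\<integral>\<^sup>+t\<in>{-pi..pi}. ennreal (star_fun (\<phi> r) t) \<partial>lborel) \<le> ennreal C"
  proof -
    let ?C = "SUP r\<in>{0<..<1}. \<integral>\<^sup>+t\<in>{-pi..pi}. ennreal (star_fun (\<phi> r) t) \<partial>lborel"
    have "?C < \<infinity>" using assms(1) by (simp add: approximate_identity_def)
    then have C: "ennreal (enn2real ?C) = ?C" by simp
    show thesis
      by (rule that[of "enn2real ?C"], simp, subst C, rule SUP_upper, simp)
  qed
  obtain K where K: "0 \<le> K" "\<forall>\<^sub>F r in at_left 1. lam r * sup_norm (\<phi> r) \<le> K"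
  proof -
    obtain k where k: "Pi_const lam \<phi> < ereal k"
      using ereal_dense2[OF assms(4)] by blast
    from Limsup_lessD[OF k[unfolded Pi_const_def]]
    have "\<forall>\<^sub>F r in at_left 1. lam r * sup_norm (\<phi> r) \<le> max k 0"
      by eventually_elim auto
    then show thesis by (intro that[of "max k 0"]) auto
  qed
  obtain c where c: "(variation_fun (\<lambda>x. \<mu> x - c * x) has_real_derivative 0) (at x\<^sub>0)"
    using assms(6) by (auto simp: strong_differentiable_at_def)
  have deriv: "deriv \<mu> x\<^sub>0 = c"
    by (rule DERIV_imp_deriv[OF strong_derivative[OF assms(5) c]])
  define \<nu> where "\<nu> = (\<lambda>x. \<mu> x - c * x)"
  have \<nu>: "BV_torus \<nu>" unfolding \<nu>_def by (rule BV_torus_minus_linear[OF assms(5)])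
  define M where "M = stieltjes_measure (variation_fun \<nu>)"
  let ?m = "measure M {x\<^sub>0-pi<..x\<^sub>0+pi}"
  have unit: "\<forall>\<^sub>F r in at_left 1. 0 < r \<and> r < (1::real)"
    by (auto simp: eventually_at_left_field intro!: exI[of _ 0])
  show ?thesis unfolding deriv
  proof (rule region_limitI)
    show "\<forall>\<^sub>F r in at_left 1. 0 \<le> lam r"
      using unit by eventually_elim (use assms(2) in \<open>auto intro: less_imp_le\<close>)
    fix e :: real assume e: "0 < e"
    \<comment> \<open>The near part is at most \<open>\<epsilon> (4 K + 2 C)\<close>; the \<open>1\<close> keeps the denominator positive.\<close>
    define \<epsilon> where "\<epsilon> = e / 3 / (4 * K + 2 * C + 1)"
    have \<epsilon>: "0 < \<epsilon>" "\<epsilon> * (4 * K + 2 * C) \<le> e / 3"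
      using e K(1) C(1) by (auto simp: \<epsilon>_def field_simps)
    obtain d where d: "0 < d" "\<And>s. 0 \<le> s \<Longrightarrow> s \<le> d \<Longrightarrow> emeasure M {x\<^sub>0-s..x\<^sub>0+s} \<le> ennreal (\<epsilon> * (2 * s))"
      using stieltjes_measure_ball_le[OF mono_variation_fun(1)[OF \<nu>] c[folded \<nu>_def] \<epsilon>(1)] unfolding M_def by blast
    define \<delta> where "\<delta> = min d (pi / 2)"
    have \<delta>: "0 < \<delta>" "\<delta> \<le> pi / 2" "\<delta> \<le> d" using d(1) by (auto simp: \<delta>_def)
    have "((\<lambda>r. star_fun (\<phi> r) (\<delta> / 2) * ?m) \<longlongrightarrow> 0 * ?m) (at_left 1)"
      using \<delta> by (intro tendsto_intros star) auto
    then have ev1: "\<forall>\<^sub>F r in at_left 1. star_fun (\<phi> r) (\<delta> / 2) * ?m < e / 3"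
      using e by (intro order_tendstoD) auto
    have "((\<lambda>r. \<bar>c * (LBINT t:{-pi..pi}. \<phi> r t) - c\<bar>) \<longlongrightarrow> \<bar>c * 1 - c\<bar>) (at_left 1)"
      by (intro tendsto_intros mass[of pi]) auto
    then have ev2: "\<forall>\<^sub>F r in at_left 1. \<bar>c * (LBINT t:{-pi..pi}. \<phi> r t) - c\<bar> < e / 3"
      using e by (intro order_tendstoD) auto
    have ev3: "\<forall>\<^sub>F r in at_left 1. lam r < \<delta> / 2"
      using \<delta> by (intro order_tendstoD[OF assms(3)]) auto
    show "\<forall>\<^sub>F r in at_left 1. \<forall>x. \<bar>x - x\<^sub>0\<bar> \<le> lam r \<longrightarrow> \<bar>Phi \<phi> r x \<mu> - c\<bar> \<le> e"
      using unit K(2) ev1 ev2 ev3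
    proof eventually_elim
      case (elim r)
      note \<phi>r = \<phi>[of r]
      show ?case
      proof (intro allI impI)
        fix x assume x: "\<bar>x - x\<^sub>0\<bar> \<le> lam r"
        have meas: "(\<lambda>t. \<phi> r (x - t)) \<in> borel_measurable borel" "bounded (range (\<lambda>t. \<phi> r (x - t)))"
          using \<phi>r elim by (auto simp: bounded_iff)
        have "Phi \<phi> r x \<mu> = c * (LBINT t:{-pi..pi}. \<phi> r t) + torus_stieltjes_integral (\<lambda>t. \<phi> r (x - t)) \<nu>"
          unfolding Phi_def \<nu>_def torus_stieltjes_integral_minus_linear[OF assms(5) meas, of c]
          using \<phi>r elim by (simp add: set_integral_lborel_reflect_periodic)
        moreover have "\<bar>torus_stieltjes_integral (\<lambda>t. \<phi> r (x - t)) \<nu>\<bar> \<le>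
            \<epsilon> * (4 * lam r * sup_norm (\<phi> r) + 2 * C) + star_fun (\<phi> r) (\<delta> / 2) * ?m"
          unfolding M_def
          by (rule abs_torus_stieltjes_kernel_le[OF \<nu>])
            (use \<phi>r elim \<delta> x C d(2) \<epsilon>(1) assms(2)[of r] in \<open>auto simp: M_def\<close>)
        moreover have "\<epsilon> * (4 * lam r * sup_norm (\<phi> r) + 2 * C) \<le> \<epsilon> * (4 * K + 2 * C)"
          using elim \<epsilon>(1) by (intro mult_left_mono) auto
        ultimately show "\<bar>Phi \<phi> r x \<mu> - c\<bar> \<le> e"
          using \<epsilon>(2) elim by linarith
      qed
    qed
  qed
qed

end
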